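(* Let $Q_1,\dots,Q_r\in\mathbb{Z}[x]$ be polynomials such that, for each $i$, $Q_i$ has $0$ as a root of multiplicity $l_i>0$, and let $A_1,\dots,A_r$ be fixed positive integers. For any irreducible $f(x)\in\mathbb{Z}[x]$ of degree $d>l_1+\cdots+l_r$, the equation $$\prod_{i=1}^r Q_i(A_i^{n_i}n_i!)=f(x)$$ has only finitely many integer solutions $(n_1,\dots,n_r,x)$.
   Context: The $n_i$ range over nonnegative integers, so that $n_i!$ is defined, and $r\geq 1$. *)

theory Defs
  imports "HOL-Computational_Algebra.Computational_Algebra" "HOL-Library.FuncSet"
begin

end

theory Submission
  imports Defs "HOL-Analysis.Summation_Tests" "HOL-Number_Theory.Cong"
begin

text \<open>
  Since \<open>n_i!\<close> divides \<open>A_i^n_i n_i!\<close> and \<open>Q_i(0) = 0\<close>, it suffices to find a modulus \<open>m\<close> such that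
  \<open>f\<close> has no root mod \<open>m\<close>: it forces all \<open>n_i < m\<close>. Such an \<open>m\<close> exists for every irreducible \<open>f\<close> of
  degree at least 2. Instead of Chebotarev's theorem the argument counts ideals in an order \<open>R\<close> of
  rank \<open>D\<close>, using that an ideal containing a nonzero element with coordinates of size \<open>n\<close> has index
  \<open>O(n^D)\<close>.

  Upper bound: an ideal of index about \<open>M\<close> contains an element with coordinates at most \<open>M^(1/D)\<close> by
  pigeonhole, and such an element lies in boundedly many such ideals. Hence there are \<open>O(M)\<close> pairs
  \<open>(m, x)\<close> with \<open>M/2 < m \<le> M\<close> and \<open>x\<close> a root of \<open>f\<close> mod \<open>m\<close>. If every modulus had a root, the primes
  with at least two roots would therefore have a convergent sum of reciprocals.

  Lower bound: in any order the primes \<open>p\<close> having an ideal of index \<open>p\<close> have a divergent sum of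
  reciprocals. Otherwise a sieve over a large cube, in which the other maximal ideals over \<open>p\<close> have
  index at least \<open>p^2\<close> and so cost little, leaves elements that lie in no maximal ideal but cannot be
  units for reasons of size.

  Applied to an order of \<open>\<rat>(\<alpha>, \<beta>)\<close> for two distinct roots of \<open>f\<close>, the lower bound contradicts the upper
  one, since an ideal of prime index \<open>p\<close> there yields two distinct roots of \<open>f\<close> mod \<open>p\<close>.
\<close>

subsection \<open>Integer combinations and integer polynomials\<close>

definition zcomb :: "'a::comm_ring_1 set \<Rightarrow> ('a \<Rightarrow> int) \<Rightarrow> 'a" where
  "zcomb B c = (\<Sum>b\<in>B. of_int (c b) * b)"

definition zspan :: "'a::comm_ring_1 set \<Rightarrow> 'a set" where
  "zspan B = range (zcomb B)"

lemma zcomb_in_zspan [simp, intro]: "zcomb B c \<in> zspan B"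
  by (simp add: zspan_def)

lemma zspanE:
  assumes "x \<in> zspan B" obtains c where "x = zcomb B c"
  using assms by (auto simp: zspan_def)

lemma zcomb_cong: "(\<And>b. b \<in> B \<Longrightarrow> c b = d b) \<Longrightarrow> zcomb B c = zcomb B d"
  by (simp add: zcomb_def)

lemma zcomb_0 [simp]: "zcomb B (\<lambda>b. 0) = 0"
  by (simp add: zcomb_def)

lemma zcomb_add: "zcomb B c + zcomb B d = zcomb B (\<lambda>b. c b + d b)"
  by (simp add: zcomb_def sum.distrib algebra_simps)

lemma zcomb_diff: "zcomb B c - zcomb B d = zcomb B (\<lambda>b. c b - d b)"
  by (simp add: zcomb_def sum_subtractf algebra_simps)

lemma zcomb_scale: "of_int k * zcomb B c = zcomb B (\<lambda>b. k * c b)"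
  by (simp add: zcomb_def sum_distrib_left algebra_simps)

lemma zcomb_single:
  assumes "finite B" "b \<in> B"
  shows "zcomb B (\<lambda>x. if x = b then k else 0) = of_int k * b"
  using assms by (simp add: zcomb_def if_distrib if_distribR sum.delta cong: if_cong)

lemma zspan_base: "finite B \<Longrightarrow> b \<in> B \<Longrightarrow> b \<in> zspan B"
  using zcomb_single[of B b 1] by (metis mult_1 of_int_1 zcomb_in_zspan)

lemma zspan_0 [simp]: "0 \<in> zspan B"
  by (metis zcomb_0 zcomb_in_zspan)

lemma zspan_add: "x \<in> zspan B \<Longrightarrow> y \<in> zspan B \<Longrightarrow> x + y \<in> zspan B"
  by (auto elim!: zspanE simp: zcomb_add)

lemma zspan_diff: "x \<in> zspan B \<Longrightarrow> y \<in> zspan B \<Longrightarrow> x - y \<in> zspan B"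
  by (auto elim!: zspanE simp: zcomb_diff)

lemma zspan_scale: "x \<in> zspan B \<Longrightarrow> of_int k * x \<in> zspan B"
  by (auto elim!: zspanE simp: zcomb_scale)

lemma zspan_sum: "(\<And>i. i \<in> S \<Longrightarrow> h i \<in> zspan B) \<Longrightarrow> sum h S \<in> zspan B"
  by (induction S rule: infinite_finite_induct) (auto intro: zspan_add)

lemma zspan_mult:
  assumes "\<And>a b. a \<in> A \<Longrightarrow> b \<in> B \<Longrightarrow> a * b \<in> zspan C" "x \<in> zspan A" "y \<in> zspan B"
  shows "x * y \<in> zspan C"
proof -
  obtain c d where x: "x = zcomb A c" and y: "y = zcomb B d"
    using assms by (auto elim!: zspanE)
  have "x * y = (\<Sum>a\<in>A. \<Sum>b\<in>B. of_int (c a * d b) * (a * b))"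
    unfolding x y zcomb_def sum_product by (simp add: algebra_simps)
  also have "\<dots> \<in> zspan C"
    using assms(1) by (intro zspan_sum zspan_scale) auto
  finally show ?thesis .
qed

section \<open>Evaluation of integer polynomials in commutative rings\<close>

definition ipoly :: "int poly \<Rightarrow> 'a::comm_ring_1 \<Rightarrow> 'a" where
  "ipoly h x = poly (map_poly of_int h) x"

lemma ipoly_0 [simp]: "ipoly 0 x = 0"
  by (simp add: ipoly_def)

lemma ipoly_pCons [simp]: "ipoly (pCons c h) x = of_int c + x * ipoly h x"
  by (simp add: ipoly_def map_poly_pCons)

lemma ipoly_add: "ipoly (p + q) x = ipoly p x + ipoly q x"
  unfolding ipoly_def by (subst poly_add [symmetric], rule arg_cong2[of _ _ _ _ poly])
    (auto intro!: poly_eqI simp: coeff_map_poly)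

lemma ipoly_smult: "ipoly (smult c p) x = of_int c * ipoly p x"
  by (induction p) (auto simp: algebra_simps)

lemma ipoly_diff: "ipoly (p - q) x = ipoly p x - ipoly q x"
  using ipoly_add[of "p - q" q x] by simp

lemma ipoly_mult: "ipoly (p * q) x = ipoly p x * ipoly q x"
  by (induction p) (auto simp: ipoly_add ipoly_smult algebra_simps)

lemma ipoly_monom: "ipoly (monom c n) x = of_int c * x ^ n"
  by (simp add: ipoly_def map_poly_monom poly_monom)

lemma ipoly_sum: "ipoly (sum h S) x = (\<Sum>i\<in>S. ipoly (h i) x)"
  by (induction S rule: infinite_finite_induct) (auto simp: ipoly_add)

lemma ipoly_altdef: "ipoly h x = (\<Sum>i\<le>degree h. of_int (coeff h i) * x ^ i)"
  by (subst (1) poly_as_sum_of_monoms[of h, symmetric]) (simp add: ipoly_sum ipoly_monom)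

lemma ipoly_of_int: "ipoly h (of_int x) = of_int (poly h x)"
  by (induction h) auto

subsection \<open>Orders\<close>

text \<open>An order of rank \<open>D\<close>, presented by a chosen Z-basis so that coordinates,
  and with them the size of an element, make sense. Having 1 in the basis confines a rational
  integer to a single coordinate.\<close>

locale z_order =
  fixes B :: "'a::{idom,ring_char_0} set"
  assumes fin: "finite B" and one: "1 \<in> B"
    and indep: "zcomb B c = 0 \<Longrightarrow> b \<in> B \<Longrightarrow> c b = 0"
    and closed: "a \<in> B \<Longrightarrow> b \<in> B \<Longrightarrow> a * b \<in> zspan B"
begin

abbreviation R where "R \<equiv> zspan B"

abbreviation D where "D \<equiv> card B"

definition cube :: "int \<Rightarrow> 'a set" where
  "cube n = zcomb B ` {c. \<forall>b\<in>B. \<bar>c b\<bar> \<le> n}"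

lemma D_pos: "D > 0"
  using fin one card_gt_0_iff by blast

lemma zcomb_inj: "zcomb B c = zcomb B d \<Longrightarrow> b \<in> B \<Longrightarrow> c b = d b"
  using indep[of "\<lambda>b. c b - d b" b] by (simp flip: zcomb_diff)

lemma cubeI: "(\<And>b. b \<in> B \<Longrightarrow> \<bar>c b\<bar> \<le> n) \<Longrightarrow> zcomb B c \<in> cube n"
  by (auto simp: cube_def)

lemma cubeE:
  assumes "x \<in> cube n" obtains c where "x = zcomb B c" "\<forall>b\<in>B. \<bar>c b\<bar> \<le> n"
  using assms by (auto simp: cube_def)

lemma cube_zcombD: "zcomb B c \<in> cube n \<Longrightarrow> b \<in> B \<Longrightarrow> \<bar>c b\<bar> \<le> n"
  by (metis cubeE zcomb_inj)

lemma cube_R: "x \<in> cube n \<Longrightarrow> x \<in> R"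
  by (auto simp: cube_def)

lemma cube_mono: "x \<in> cube m \<Longrightarrow> m \<le> n \<Longrightarrow> x \<in> cube n"
  by (fastforce simp: cube_def)

lemma cube_add: "x \<in> cube m \<Longrightarrow> y \<in> cube n \<Longrightarrow> x + y \<in> cube (m + n)"
  by (elim cubeE) (fastforce simp: zcomb_add intro!: cubeI intro: order.trans[OF abs_triangle_ineq] add_mono)

lemma cube_diff: "x \<in> cube m \<Longrightarrow> y \<in> cube n \<Longrightarrow> x - y \<in> cube (m + n)"
  by (elim cubeE) (fastforce simp: zcomb_diff intro!: cubeI intro: order.trans[OF abs_triangle_ineq4] add_mono)

lemma cube_scale: "x \<in> cube n \<Longrightarrow> of_int k * x \<in> cube (\<bar>k\<bar> * n)"
  by (elim cubeE) (auto simp: zcomb_scale abs_mult intro!: cubeI mult_left_mono)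

lemma of_int_eq_zcomb: "of_int k = zcomb B (\<lambda>b. if b = 1 then k else 0)"
  using zcomb_single[OF fin one] by simp

lemma of_int_cube: "of_int k \<in> cube \<bar>k\<bar>"
  unfolding of_int_eq_zcomb by (rule cubeI) auto

lemma of_int_R [simp]: "of_int k \<in> R"
  using of_int_cube cube_R by blast

lemma one_R [simp]: "1 \<in> R"
  using of_int_R[of 1] by simp

lemma mult_R: "x \<in> R \<Longrightarrow> y \<in> R \<Longrightarrow> x * y \<in> R"
  using zspan_mult closed by blast

lemma R_imp_cube: "x \<in> R \<Longrightarrow> \<exists>n. x \<in> cube n"
proof -
  assume "x \<in> R"
  then obtain c where x: "x = zcomb B c" by (rule zspanE)
  have "x \<in> cube (\<Sum>b\<in>B. \<bar>c b\<bar>)"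
    unfolding x by (rule cubeI) (use fin in \<open>auto intro!: member_le_sum\<close>)
  then show ?thesis ..
qed

lemma cube_0: "cube 0 = {0}"
proof -
  have "zcomb B c = 0" if "\<forall>b\<in>B. c b = 0" for c
    using zcomb_cong[of B c "\<lambda>_. 0"] that by simp
  then show ?thesis
    by (force simp: cube_def intro: image_eqI[of _ _ "\<lambda>_. 0"])
qed

text \<open>Multiplication is bilinear with structure constants \<open>e a b z\<close>;
  \<open>K\<close> is one more than the sum of their absolute values.\<close>

lemma ex_mult_bound:
  "\<exists>K\<ge>1. \<forall>m n x y. m \<ge> 0 \<longrightarrow> n \<ge> 0 \<longrightarrow> x \<in> cube m \<longrightarrow> y \<in> cube n \<longrightarrow> x * y \<in> cube (K * m * n)"
proof -
  have "\<forall>a\<in>B. \<forall>b\<in>B. \<exists>c. a * b = zcomb B c"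
    using closed by (meson zspanE)
  then obtain e where e: "\<And>a b. a \<in> B \<Longrightarrow> b \<in> B \<Longrightarrow> a * b = zcomb B (e a b)"
    by metis
  define K where "K = 1 + (\<Sum>a\<in>B. \<Sum>b\<in>B. \<Sum>x\<in>B. \<bar>e a b x\<bar>)"
  have "x * y \<in> cube (K * m * n)" if "m \<ge> 0" "n \<ge> 0" "x \<in> cube m" "y \<in> cube n" for m n x y
  proof -
    obtain c where x: "x = zcomb B c" and c: "\<forall>b\<in>B. \<bar>c b\<bar> \<le> m"
      using \<open>x \<in> cube m\<close> by (rule cubeE)
    obtain d where y: "y = zcomb B d" and d: "\<forall>b\<in>B. \<bar>d b\<bar> \<le> n"
      using \<open>y \<in> cube n\<close> by (rule cubeE)
    have "x * y = (\<Sum>a\<in>B. \<Sum>b\<in>B. of_int (c a * d b) * (a * b))"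
      unfolding x y zcomb_def sum_product by (simp add: algebra_simps)
    also have "\<dots> = (\<Sum>a\<in>B. \<Sum>b\<in>B. of_int (c a * d b) * (\<Sum>z\<in>B. of_int (e a b z) * z))"
      using e by (intro sum.cong) (auto simp: zcomb_def)
    also have "\<dots> = (\<Sum>a\<in>B. \<Sum>b\<in>B. \<Sum>z\<in>B. of_int (c a * d b * e a b z) * z)"
      by (simp add: sum_distrib_left algebra_simps)
    also have "\<dots> = (\<Sum>a\<in>B. \<Sum>z\<in>B. \<Sum>b\<in>B. of_int (c a * d b * e a b z) * z)"
      by (rule sum.cong[OF refl sum.swap])
    also have "\<dots> = (\<Sum>z\<in>B. \<Sum>a\<in>B. \<Sum>b\<in>B. of_int (c a * d b * e a b z) * z)"
      by (rule sum.swap)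
    also have "\<dots> = zcomb B (\<lambda>z. \<Sum>a\<in>B. \<Sum>b\<in>B. c a * d b * e a b z)"
      by (simp add: zcomb_def sum_distrib_right)
    also have "\<dots> \<in> cube (K * m * n)"
    proof (rule cubeI)
      fix z assume z: "z \<in> B"
      have "\<bar>\<Sum>a\<in>B. \<Sum>b\<in>B. c a * d b * e a b z\<bar> \<le> (\<Sum>a\<in>B. \<Sum>b\<in>B. \<bar>c a * d b * e a b z\<bar>)"
        by (rule order.trans[OF sum_abs]) (intro sum_mono sum_abs)
      also have "\<dots> \<le> (\<Sum>a\<in>B. \<Sum>b\<in>B. (m * n) * (\<Sum>z\<in>B. \<bar>e a b z\<bar>))"
      proof (intro sum_mono)
        fix a b assume ab: "a \<in> B" "b \<in> B"
        have "\<bar>e a b z\<bar> \<le> (\<Sum>z\<in>B. \<bar>e a b z\<bar>)"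
          using z fin by (intro member_le_sum) auto
        then show "\<bar>c a * d b * e a b z\<bar> \<le> (m * n) * (\<Sum>z\<in>B. \<bar>e a b z\<bar>)"
          unfolding abs_mult using c d ab that by (intro mult_mono) auto
      qed
      also have "\<dots> = (m * n) * (K - 1)"
        by (simp add: K_def sum_distrib_left)
      also have "\<dots> \<le> K * m * n"
        using that by (simp add: algebra_simps)
      finally show "\<bar>\<Sum>a\<in>B. \<Sum>b\<in>B. c a * d b * e a b z\<bar> \<le> K * m * n" .
    qed
    finally show ?thesis .
  qed
  moreover have "K \<ge> 1"
    unfolding K_def by (simp add: sum_nonneg)
  ultimately show ?thesis by blast
qed

definition K :: int where
  "K = (SOME K. K \<ge> 1 \<and> (\<forall>m n x y. m \<ge> 0 \<longrightarrow> n \<ge> 0 \<longrightarrow> x \<in> cube m \<longrightarrow> y \<in> cube n \<longrightarrow> x * y \<in> cube (K * m * n)))"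

lemma K_ge: "K \<ge> 1"
  and cube_mult: "m \<ge> 0 \<Longrightarrow> n \<ge> 0 \<Longrightarrow> x \<in> cube m \<Longrightarrow> y \<in> cube n \<Longrightarrow> x * y \<in> cube (K * m * n)"
  using someI_ex[OF ex_mult_bound, folded K_def] by blast+

lemma cube_eq_PiE: "cube n = zcomb B ` (B \<rightarrow>\<^sub>E {-n..n})"
proof -
  have "x \<in> zcomb B ` (B \<rightarrow>\<^sub>E {-n..n})" if "x \<in> cube n" for x
  proof -
    obtain c where c: "x = zcomb B c" "\<forall>b\<in>B. \<bar>c b\<bar> \<le> n"
      using \<open>x \<in> cube n\<close> by (rule cubeE)
    then have "x = zcomb B (restrict c B)" "restrict c B \<in> B \<rightarrow>\<^sub>E {-n..n}"
      by (auto intro: zcomb_cong simp: abs_le_iff)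
    then show ?thesis by blast
  qed
  moreover have "zcomb B c \<in> cube n" if "c \<in> B \<rightarrow>\<^sub>E {-n..n}" for c
    by (rule cubeI) (use that in \<open>force simp: abs_le_iff PiE_iff\<close>)
  ultimately show ?thesis by auto
qed

lemma finite_cube [simp]: "finite (cube n)"
  unfolding cube_eq_PiE using fin by (auto intro!: finite_PiE)

lemma card_cube: "n \<ge> 0 \<Longrightarrow> card (cube n) \<le> nat (2 * n + 1) ^ D"
  unfolding cube_eq_PiE
  by (rule order.trans[OF card_image_le]) (use fin in \<open>auto intro!: finite_PiE simp: card_PiE algebra_simps nat_diff_distrib nat_add_distrib\<close>)

lemma card_cube': "n \<ge> 1 \<Longrightarrow> card (cube n) \<le> nat (3 * n) ^ D"
  by (rule order.trans[OF card_cube]) (auto intro!: power_mono)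

lemma zcomb_inj_on_PiE: "inj_on (zcomb B) (B \<rightarrow>\<^sub>E S)"
  by (rule inj_onI) (metis zcomb_inj PiE_ext)

lemma card_zcomb_PiE: "finite S \<Longrightarrow> card (zcomb B ` (B \<rightarrow>\<^sub>E S)) = card S ^ D"
  using fin by (simp add: card_image[OF zcomb_inj_on_PiE] card_PiE)

subsection \<open>Ideals and the covering lemma\<close>

lemma ipoly_R: "g \<in> R \<Longrightarrow> ipoly h g \<in> R"
  by (induction h) (auto intro!: zspan_add mult_R)

text \<open>Pigeonhole on the combinations of the powers \<open>g ^ k\<close> with
  \<open>k \<le> D\<close>: coefficients in \<open>{0..<T}\<close> allow \<open>T ^ (D + 1)\<close>
  choices, but the values lie in a cube with only O(\<open>T ^ D\<close>) elements. Two choices with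
  equal value differ by an annihilating polynomial.\<close>

lemma ex_annihilating_poly:
  assumes g: "g \<in> R"
  shows "\<exists>h. h \<noteq> 0 \<and> ipoly h g = 0"
proof -
  have "g ^ k \<in> R" for k
    by (induction k) (auto intro: mult_R g)
  then have "\<forall>k. \<exists>n. g ^ k \<in> cube n"
    using R_imp_cube by blast
  then obtain n where n: "\<And>k. g ^ k \<in> cube (n k)"
    by metis
  define N where "N = 1 + (\<Sum>k\<le>D. \<bar>n k\<bar>)"
  have N: "N \<ge> 1"
    by (simp add: N_def sum_nonneg)
  have gN: "g ^ k \<in> cube N" if "k \<le> D" for k
  proof (rule cube_mono[OF n])
    have "\<bar>n k\<bar> \<le> (\<Sum>k\<le>D. \<bar>n k\<bar>)"
      using that by (intro member_le_sum) auto
    then show "n k \<le> N" by (simp add: N_def)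
  qed
  \<comment> \<open>The cube that holds all values has at most \<open>(A * nat T) ^ D\<close>
    elements, so \<open>T > A ^ D\<close> is what makes \<open>T ^ (D + 1)\<close> exceed
    it.\<close>
  define A where "A = nat (3 * (int D + 1) * N)"
  define T where "T = int (A ^ D + 1)"
  define val where "val = (\<lambda>a. \<Sum>k\<le>D. of_int (a k) * g ^ k)"
  have val_cube: "val a \<in> cube ((int D + 1) * (T * N))" if "a \<in> {..D} \<rightarrow>\<^sub>E {0..<T}" for a
  proof -
    have "(\<Sum>k\<in>S. of_int (a k) * g ^ k) \<in> cube (int (card S) * (T * N))" if "finite S" "S \<subseteq> {..D}" for S
      using that
    proof (induction S)
      case empty
      then show ?case by (simp add: cube_0)
    next
      case (insert k S)
      have "of_int (a k) * g ^ k \<in> cube (\<bar>a k\<bar> * N)"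
        using insert by (intro cube_scale gN) auto
      moreover have "\<bar>a k\<bar> * N \<le> T * N"
      proof (rule mult_right_mono)
        have "a k \<in> {0..<T}"
          using insert.prems \<open>a \<in> _\<close> by auto
        then show "\<bar>a k\<bar> \<le> T" by auto
      qed (use N in simp)
      ultimately have "of_int (a k) * g ^ k \<in> cube (T * N)"
        using cube_mono by blast
      from cube_add[OF this insert.IH] show ?case
        using insert by (simp add: algebra_simps)
    qed
    from this[of "{..D}"] show ?thesis
      by (simp add: val_def add.commute)
  qed
  have T: "T \<ge> 1" by (simp add: T_def)
  have "\<not> inj_on val ({..D} \<rightarrow>\<^sub>E {0..<T})"
  proof
    assume "inj_on val ({..D} \<rightarrow>\<^sub>E {0..<T})"
    then have "card ({..D} \<rightarrow>\<^sub>E {0..<T}) \<le> card (cube ((int D + 1) * (T * N)))"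
      using val_cube by (intro card_inj_on_le) auto
    also have "\<dots> \<le> nat (3 * ((int D + 1) * (T * N))) ^ D"
    proof (rule card_cube')
      have "1 * (1 * 1) \<le> (int D + 1) * (T * N)"
        using T N by (intro mult_mono) auto
      then show "1 \<le> (int D + 1) * (T * N)" by simp
    qed
    also have "nat (3 * ((int D + 1) * (T * N))) = A * nat T"
      unfolding A_def using T N by (simp flip: nat_mult_distrib add: algebra_simps)
    also have "(A * nat T) ^ D = A ^ D * nat T ^ D"
      by (simp add: power_mult_distrib)
    also have "\<dots> < nat T * nat T ^ D"
    proof (rule mult_strict_right_mono)
      show "A ^ D < nat T" unfolding T_def by linarith
      show "0 < nat T ^ D" using T by simp
    qed
    also have "\<dots> = card ({..D} \<rightarrow>\<^sub>E {0..<T})"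
      by (simp add: card_PiE)
    finally show False by simp
  qed
  then obtain a a' where a: "a \<in> {..D} \<rightarrow>\<^sub>E {0..<T}" "a' \<in> {..D} \<rightarrow>\<^sub>E {0..<T}" "val a = val a'" "a \<noteq> a'"
    by (auto simp: inj_on_def)
  then obtain k where k: "k \<le> D" "a k \<noteq> a' k"
    using PiE_ext by (metis atMost_iff)
  define h where "h = (\<Sum>k\<le>D. monom (a k - a' k) k)"
  have "coeff h k = a k - a' k"
    using k by (simp add: h_def coeff_sum if_distrib sum.delta cong: if_cong)
  then have "h \<noteq> 0"
    using k by auto
  moreover have "ipoly h g = val a - val a'"
    by (simp add: h_def val_def ipoly_sum ipoly_monom sum_subtractf algebra_simps)
  ultimately show ?thesis
    using a by auto
qed

text \<open>In a domain, powers of \<open>g\<close> can be cancelled from the relation until its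
  constant term is nonzero; that term is then a multiple of \<open>g\<close>.\<close>

lemma ipoly_eq_0_imp:
  fixes g :: 'a
  shows "h \<noteq> 0 \<Longrightarrow> ipoly h g = 0 \<Longrightarrow> g \<noteq> 0 \<Longrightarrow> \<exists>k h'. k \<noteq> 0 \<and> of_int k = g * ipoly h' g"
proof (induction h)
  case (pCons c p)
  show ?case
  proof (cases "c = 0")
    case True
    with pCons show ?thesis by auto
  next
    case False
    then have "of_int (-c) = g * ipoly p g"
      using pCons.prems by (simp add: add_eq_0_iff)
    with False show ?thesis by (metis neg_equal_0_iff_equal)
  qed
qed auto

text \<open>A substitute for the norm: \<open>s / N\<close> is the inverse of \<open>g\<close> in
  the fraction field, so division by \<open>g\<close> becomes coordinatewise division by an
  integer.\<close>

lemma ex_inverse: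
  assumes "g \<in> R" "g \<noteq> 0"
  shows "\<exists>s\<in>R. \<exists>N>0. g * s = of_int N"
proof -
  obtain h where "h \<noteq> 0" "ipoly h g = 0"
    using ex_annihilating_poly assms by blast
  then obtain k h' where k: "k \<noteq> 0" "of_int k = g * ipoly h' g"
    using ipoly_eq_0_imp assms by blast
  have "g * (of_int (sgn k) * ipoly h' g) = of_int \<bar>k\<bar>"
    using k by (simp add: abs_sgn algebra_simps)
  moreover have "of_int (sgn k) * ipoly h' g \<in> R"
    using assms by (intro mult_R ipoly_R) auto
  ultimately show ?thesis
    using k by (metis zero_less_abs_iff)
qed

text \<open>Division with remainder: rounding x/g down coordinatewise leaves \<open>g\<close> times
  an element with coordinates in [0,1), which has size at most \<open>K * n\<close>.\<close>

lemma covering: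
  assumes "g \<in> cube n" "g \<noteq> 0" "n \<ge> 0" "x \<in> R"
  shows "\<exists>q\<in>R. x - g * q \<in> cube (K * n)"
proof -
  obtain s N where s: "s \<in> R" "N > 0" "g * s = of_int N"
    using ex_inverse assms cube_R by blast
  obtain c where c: "x * s = zcomb B c"
    using mult_R[OF assms(4) s(1)] by (blast elim: zspanE)
  \<comment> \<open>Since \<open>s / N\<close> is the inverse of \<open>g\<close>, the coordinates
    of x/g are \<open>c b / N\<close>. Thus \<open>q\<close> is the floor of x/g and
    \<open>r\<close> is \<open>N\<close> times its fractional part; the factor \<open>N\<close> is
    cancelled at the end.\<close>
  define q where "q = zcomb B (\<lambda>b. c b div N)"
  define r where "r = zcomb B (\<lambda>b. c b mod N)"
  have "x * s = of_int N * q + r"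
    unfolding c q_def r_def zcomb_scale zcomb_add by simp
  then have "of_int N * x = g * (of_int N * q + r)"
    using s(3) by (metis mult.commute mult.left_commute)
  then have eq: "of_int N * (x - g * q) = g * r"
    by (simp add: algebra_simps)
  have "q \<in> R" by (simp add: q_def)
  then have "x - g * q \<in> R"
    using assms cube_R by (intro zspan_diff mult_R) auto
  then obtain d where d: "x - g * q = zcomb B d"
    by (rule zspanE)
  have "r \<in> cube N"
    unfolding r_def using s(2) by (intro cubeI) (auto simp: less_imp_le)
  then have "g * r \<in> cube (K * n * N)"
    using assms s by (intro cube_mult) auto
  then have dN: "zcomb B (\<lambda>b. N * d b) \<in> cube (K * n * N)"
    by (simp flip: eq add: d zcomb_scale)
  have "zcomb B d \<in> cube (K * n)"
  proof (rule cubeI)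
    fix b assume "b \<in> B"
    from cube_zcombD[OF dN this] have "\<bar>d b\<bar> * N \<le> K * n * N"
      using s(2) by (simp add: abs_mult mult.commute)
    then show "\<bar>d b\<bar> \<le> K * n"
      using s(2) by simp
  qed
  with \<open>q \<in> R\<close> d show ?thesis by metis
qed

section \<open>Ideals and upper bounds for their index\<close>

definition is_ideal :: "'a set \<Rightarrow> bool" where
  "is_ideal I \<longleftrightarrow> I \<subseteq> R \<and> 0 \<in> I \<and> (\<forall>x\<in>I. \<forall>y\<in>I. x - y \<in> I) \<and> (\<forall>x\<in>I. \<forall>y\<in>R. x * y \<in> I)"

lemma ideal_R: "is_ideal I \<Longrightarrow> x \<in> I \<Longrightarrow> x \<in> R"
  and ideal_0: "is_ideal I \<Longrightarrow> 0 \<in> I"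
  and ideal_diff: "is_ideal I \<Longrightarrow> x \<in> I \<Longrightarrow> y \<in> I \<Longrightarrow> x - y \<in> I"
  and ideal_mult: "is_ideal I \<Longrightarrow> x \<in> I \<Longrightarrow> y \<in> R \<Longrightarrow> x * y \<in> I"
  by (auto simp: is_ideal_def)

lemma ideal_mult': "is_ideal I \<Longrightarrow> x \<in> I \<Longrightarrow> y \<in> R \<Longrightarrow> y * x \<in> I"
  using ideal_mult by (simp add: mult.commute)

lemma ideal_uminus: "is_ideal I \<Longrightarrow> x \<in> I \<Longrightarrow> - x \<in> I"
  using ideal_diff[of I 0 x] ideal_0 by simp

lemma ideal_add: "is_ideal I \<Longrightarrow> x \<in> I \<Longrightarrow> y \<in> I \<Longrightarrow> x + y \<in> I"
  using ideal_diff[of I x "- y"] ideal_uminus by simp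

lemma is_ideal_principal:
  assumes "g \<in> R"
  shows "is_ideal ((*) g ` R)"
proof -
  have "g * x - g * y \<in> (*) g ` R" if "x \<in> R" "y \<in> R" for x y
    using that by (metis imageI right_diff_distrib zspan_diff)
  moreover have "g * x * y \<in> (*) g ` R" if "x \<in> R" "y \<in> R" for x y
    using that by (metis imageI mult.assoc mult_R)
  moreover have "0 \<in> (*) g ` R"
    by (metis imageI mult_zero_right zspan_0)
  ultimately show ?thesis
    using assms by (auto simp: is_ideal_def mult_R)
qed

lemma ideal_principal_subset: "is_ideal I \<Longrightarrow> g \<in> I \<Longrightarrow> (*) g ` R \<subseteq> I"
  using ideal_mult by auto

text \<open>A finite witness that \<open>I\<close> has index at least \<open>card E\<close>, which
  permits index estimates without quotient rings.\<close>

definition incongruent :: "'a set \<Rightarrow> 'a set \<Rightarrow> bool" where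
  "incongruent I E \<longleftrightarrow> E \<subseteq> R \<and> finite E \<and> (\<forall>x\<in>E. \<forall>y\<in>E. x - y \<in> I \<longrightarrow> x = y)"

text \<open>By \<open>covering\<close> every class modulo \<open>g\<close> has a representative in
  \<open>cube (K * n)\<close>, so the size of this cube bounds the index.\<close>

lemma incongruent_card_le:
  assumes I: "is_ideal I" and g: "g \<in> I" "g \<in> cube n" "g \<noteq> 0" and n: "n \<ge> 1"
    and E: "incongruent I E"
  shows "card E \<le> nat (3 * K * n) ^ D"
proof -
  have "\<forall>x\<in>E. \<exists>y. y \<in> cube (K * n) \<and> x - y \<in> I"
  proof
    fix x assume "x \<in> E"
    then obtain q where q: "q \<in> R" "x - g * q \<in> cube (K * n)"
      using covering[OF g(2,3), of x] n E by (auto simp: incongruent_def)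
    moreover have "x - (x - g * q) \<in> I"
      using I g q by (simp add: ideal_mult)
    ultimately show "\<exists>y. y \<in> cube (K * n) \<and> x - y \<in> I" by blast
  qed
  then obtain \<rho> where \<rho>: "\<And>x. x \<in> E \<Longrightarrow> \<rho> x \<in> cube (K * n)" "\<And>x. x \<in> E \<Longrightarrow> x - \<rho> x \<in> I"
    by metis
  have "inj_on \<rho> E"
  proof (rule inj_onI)
    fix x y assume "x \<in> E" "y \<in> E" "\<rho> x = \<rho> y"
    then have "(x - \<rho> x) - (y - \<rho> y) \<in> I"
      by (intro ideal_diff[OF I] \<rho>(2))
    then show "x = y"
      using E \<open>\<rho> x = \<rho> y\<close> \<open>x \<in> E\<close> \<open>y \<in> E\<close> by (auto simp: incongruent_def)
  qed
  then have "card E \<le> card (cube (K * n))"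
    using \<rho> by (intro card_inj_on_le[of \<rho>]) auto
  also have "\<dots> \<le> nat (3 * (K * n)) ^ D"
    using mult_mono[OF K_ge n] K_ge by (intro card_cube') auto
  finally show ?thesis by (simp add: mult.assoc)
qed

subsection \<open>Ideals with cyclic quotient\<close>

text \<open>The integers map onto \<open>R / I\<close> with kernel generated by \<open>m\<close>:
  the quotient is Z/m and the index of \<open>I\<close> is exactly \<open>m\<close>.\<close>

definition cyclic_ideal :: "int \<Rightarrow> 'a set \<Rightarrow> bool" where
  "cyclic_ideal m I \<longleftrightarrow> is_ideal I \<and> m > 0 \<and> (\<forall>k. of_int k \<in> I \<longleftrightarrow> m dvd k) \<and>
     (\<forall>x\<in>R. \<exists>k. x - of_int k \<in> I)"

lemma cyclic_ideal_is_ideal: "cyclic_ideal m I \<Longrightarrow> is_ideal I"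
  and cyclic_ideal_of_int: "cyclic_ideal m I \<Longrightarrow> of_int k \<in> I \<longleftrightarrow> m dvd k"
  by (auto simp: cyclic_ideal_def)

text \<open>Pigeonhole: the \<open>(n + 1) ^ D\<close> elements with coordinates in
  \<open>{0..n}\<close> outnumber the \<open>m\<close> classes modulo \<open>I\<close>, and two
  congruent ones have a small difference.\<close>

lemma cyclic_ideal_small_element:
  assumes I: "cyclic_ideal m I" and n: "n \<ge> 0" and m: "m < (n + 1) ^ D"
  shows "\<exists>g\<in>I. g \<noteq> 0 \<and> g \<in> cube n"
proof -
  have "\<forall>x\<in>R. \<exists>k. k \<in> {0..<m} \<and> x - of_int k \<in> I"
  proof
    fix x assume "x \<in> R"
    then obtain k where k: "x - of_int k \<in> I"
      using I by (auto simp: cyclic_ideal_def)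
    have "of_int (k - k mod m) \<in> I"
      unfolding cyclic_ideal_of_int[OF I] by (rule dvd_minus_mod)
    with k have "x - of_int k + of_int (k - k mod m) \<in> I"
      by (rule ideal_add[OF cyclic_ideal_is_ideal[OF I]])
    moreover have "k mod m \<in> {0..<m}"
      using I by (simp add: cyclic_ideal_def)
    ultimately show "\<exists>k. k \<in> {0..<m} \<and> x - of_int k \<in> I"
      by (intro exI[of _ "k mod m"]) auto
  qed
  then obtain \<phi> where \<phi>: "\<And>x. x \<in> R \<Longrightarrow> \<phi> x \<in> {0..<m}" "\<And>x. x \<in> R \<Longrightarrow> x - of_int (\<phi> x) \<in> I"
    by metis
  define X where "X = zcomb B ` (B \<rightarrow>\<^sub>E {0..n})"
  have "\<not> inj_on \<phi> X"
  proof
    assume "inj_on \<phi> X"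
    then have "card X \<le> card {0..<m}"
      using \<phi>(1) by (intro card_inj_on_le) (auto simp: X_def)
    moreover have "card X = nat (n + 1) ^ D"
      by (simp add: X_def card_zcomb_PiE)
    ultimately have "nat (n + 1) ^ D \<le> nat m" by simp
    then have "int (nat (n + 1) ^ D) \<le> m"
      using I by (simp add: cyclic_ideal_def le_nat_iff)
    with m n show False by simp
  qed
  then obtain x y where xy: "x \<in> X" "y \<in> X" "\<phi> x = \<phi> y" "x \<noteq> y"
    by (auto simp: inj_on_def)
  then obtain c d where cd: "c \<in> B \<rightarrow>\<^sub>E {0..n}" "d \<in> B \<rightarrow>\<^sub>E {0..n}" "x = zcomb B c" "y = zcomb B d"
    by (auto simp: X_def)
  have "x - y \<in> cube n"
    unfolding cd(3,4) zcomb_diff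
  proof (rule cubeI)
    fix b assume "b \<in> B"
    then have "c b \<in> {0..n}" "d b \<in> {0..n}"
      using cd by auto
    then show "\<bar>c b - d b\<bar> \<le> n" by auto
  qed
  moreover have "x \<in> R" "y \<in> R"
    using cd by auto
  then have "(x - of_int (\<phi> x)) - (y - of_int (\<phi> y)) \<in> I"
    by (intro ideal_diff[OF cyclic_ideal_is_ideal[OF I]] \<phi>(2))
  then have "x - y \<in> I"
    using xy by simp
  ultimately show ?thesis
    using xy by (intro bexI[of _ "x - y"]) auto
qed

text \<open>The index of g R in \<open>I\<close> is the index of g R in \<open>R\<close> divided by
  \<open>m\<close>, hence at most \<open>L\<close>. So the class of \<open>h\<close> in I / g R has
  additive order at most \<open>L\<close>.\<close>

lemma cyclic_ideal_multiple_principal: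
  assumes I: "cyclic_ideal m I" and g: "g \<in> I" "g \<noteq> 0" "g \<in> cube n" and n: "n \<ge> 1"
    and L: "nat (3 * K * n) ^ D < nat m * (L + 1)" and h: "h \<in> I"
  shows "\<exists>k\<in>{1..int L}. of_int k * h \<in> (*) g ` R"
proof (rule ccontr)
  assume no: "\<not> ?thesis"
  have id: "is_ideal I"
    using I by (simp add: cyclic_ideal_def)
  have hR: "h \<in> R" and gR: "g \<in> R"
    using id h g by (auto intro: ideal_R)
  have id': "is_ideal ((*) g ` R)"
    using is_ideal_principal gR by blast
  \<comment> \<open>If no multiple worked, these \<open>m * (L + 1)\<close> elements would be
    pairwise incongruent modulo g R, too many for \<open>incongruent_card_le\<close>. Reduction
    modulo \<open>I\<close> recovers \<open>i\<close>, and the assumption \<open>no\<close> then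
    recovers \<open>j\<close>.\<close>
  define \<psi> where "\<psi> = (\<lambda>(i, j). of_int i + of_int j * h :: 'a)"
  define Z where "Z = {0..<m} \<times> {0..int L}"
  have key: "u = v" if uv: "u \<in> Z" "v \<in> Z" "\<psi> u - \<psi> v \<in> (*) g ` R" for u v
  proof -
    obtain i j i' j' where e: "u = (i, j)" "v = (i', j')"
      by fastforce
    have P: "of_int (i - i') + of_int (j - j') * h \<in> (*) g ` R"
      using uv(3) by (simp add: \<psi>_def e algebra_simps)
    then have "of_int (i - i') + of_int (j - j') * h \<in> I"
      using ideal_principal_subset[OF id g(1)] by (rule subsetD[rotated])
    then have "(of_int (i - i') + of_int (j - j') * h) - of_int (j - j') * h \<in> I"
      by (rule ideal_diff[OF id]) (intro ideal_mult' id h of_int_R)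
    then have "of_int (i - i') \<in> I"
      by simp
    then have "m dvd i - i'"
      by (simp add: cyclic_ideal_of_int[OF I] del: of_int_diff)
    moreover have "\<bar>i - i'\<bar> < m"
      using uv by (auto simp: e Z_def)
    ultimately have i: "i = i'"
      using dvd_imp_le_int[of "i - i'" m] by (cases "i = i'") simp_all
    have "j = j'"
    proof (rule ccontr)
      assume "j \<noteq> j'"
      have P': "of_int (j - j') * h \<in> (*) g ` R"
        using P i by (simp del: of_int_diff)
      have "of_int (sgn (j - j')) * (of_int (j - j') * h) \<in> (*) g ` R"
        by (intro ideal_mult'[OF id' P'] of_int_R)
      then have "of_int \<bar>j - j'\<bar> * h \<in> (*) g ` R"
        by (simp only: abs_sgn of_int_mult mult_ac)
      moreover have "\<bar>j - j'\<bar> \<in> {1..int L}"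
        using uv \<open>j \<noteq> j'\<close> by (auto simp: e Z_def)
      ultimately show False
        using no by blast
    qed
    with i e show ?thesis by simp
  qed
  have "inj_on \<psi> Z"
    using ideal_0[OF id'] by (intro inj_onI key) simp_all
  moreover have "incongruent ((*) g ` R) (\<psi> ` Z)"
    unfolding incongruent_def
  proof (intro conjI ballI impI)
    show "\<psi> ` Z \<subseteq> R"
      by (auto simp: \<psi>_def intro!: zspan_add mult_R hR)
    show "finite (\<psi> ` Z)"
      by (simp add: Z_def)
  next
    fix x y assume "x \<in> \<psi> ` Z" "y \<in> \<psi> ` Z" "x - y \<in> (*) g ` R"
    then show "x = y"
      using key by blast
  qed
  then have "card (\<psi> ` Z) \<le> nat (3 * K * n) ^ D"
    using incongruent_card_le[OF id' _ g(3,2) n] by (metis image_eqI mult_1_right one_R)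
  ultimately have "card Z \<le> nat (3 * K * n) ^ D"
    by (simp add: card_image)
  then show False
    using L by (simp add: Z_def card_cartesian_product nat_add_distrib)
qed

text \<open>An ideal between \<open>g R\<close> and \<open>(1/F) g R\<close> is determined by a subset of \<open>R / F R\<close>.\<close>

lemma card_ideals_between:
  assumes g: "g \<noteq> 0" and F: "F > 0"
    and S: "\<And>I. I \<in> S \<Longrightarrow> is_ideal I \<and> g \<in> I \<and> (\<forall>h\<in>I. of_int F * h \<in> (*) g ` R)"
  shows "finite S \<and> card S \<le> 2 ^ (nat F ^ D)"
proof -
  \<comment> \<open>\<open>T I\<close> lists the coordinates, reduced modulo \<open>F\<close>, of
    the elements F h / g with \<open>h\<close> in \<open>I\<close>. Adding \<open>g * e\<close> to
    \<open>h\<close> shifts them by multiples of \<open>F\<close>, so the reduced ones determine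
    \<open>I\<close>.\<close>
  define T where "T = (\<lambda>I. {c \<in> B \<rightarrow>\<^sub>E {0..<F}. \<exists>h\<in>I. of_int F * h = g * zcomb B c})"
  have sub: "I \<subseteq> J" if IJ: "I \<in> S" "J \<in> S" "T I = T J" for I J
  proof
    fix h assume h: "h \<in> I"
    have "of_int F * h \<in> (*) g ` R"
      using S[OF IJ(1)] h by blast
    then obtain q where "q \<in> R" "of_int F * h = g * q"
      by auto
    then obtain c where c: "of_int F * h = g * zcomb B c"
      by (auto elim: zspanE)
    define d where "d = restrict (\<lambda>b. c b mod F) B"
    define e where "e = zcomb B (\<lambda>b. c b div F)"
    have d: "zcomb B d = zcomb B (\<lambda>b. c b mod F)"
      by (rule zcomb_cong) (simp add: d_def)
    have "zcomb B c = of_int F * e + zcomb B d"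
      unfolding d e_def zcomb_scale zcomb_add by simp
    with c have 1: "of_int F * (h - g * e) = g * zcomb B d"
      by (simp add: algebra_simps)
    moreover have "h - g * e \<in> I"
      using S[OF IJ(1)] h by (intro ideal_diff ideal_mult) (auto simp: e_def)
    moreover have "d \<in> B \<rightarrow>\<^sub>E {0..<F}"
      using F by (auto simp: d_def)
    ultimately have "d \<in> T I"
      by (auto simp: T_def)
    then have "d \<in> T J"
      using IJ by simp
    then obtain h' where h': "h' \<in> J" "of_int F * h' = g * zcomb B d"
      by (auto simp: T_def)
    with 1 F have "h' = h - g * e"
      by (metis mult_cancel_left of_int_eq_0_iff less_irrefl)
    then have "h = h' + g * e" by simp
    also have "\<dots> \<in> J"
      using S[OF IJ(2)] h' by (intro ideal_add ideal_mult) (auto simp: e_def)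
    finally show "h \<in> J" .
  qed
  have inj: "inj_on T S"
    using sub by (intro inj_onI equalityI) auto
  have "finite (B \<rightarrow>\<^sub>E {0..<F})"
    using fin by (intro finite_PiE) auto
  then have fin': "finite (Pow (B \<rightarrow>\<^sub>E {0..<F}))" by simp
  have "T ` S \<subseteq> Pow (B \<rightarrow>\<^sub>E {0..<F})"
    by (auto simp: T_def)
  then have "finite S" "card S \<le> card (Pow (B \<rightarrow>\<^sub>E {0..<F}))"
    using inj fin' by (auto intro: inj_on_finite card_inj_on_le)
  then show ?thesis
    using fin by (simp add: card_Pow card_PiE finite_PiE)
qed

text \<open>Every such ideal contains a nonzero \<open>g\<close> of size at most the
  \<open>D\<close>-th root of \<open>M\<close>. There are O(\<open>M\<close>) such \<open>g\<close>,
  and each lies in boundedly many of the ideals because g R has bounded index in them.\<close>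

lemma ex_card_cyclic_ideals_le:
  "\<exists>C. \<forall>M\<ge>1. \<forall>S. (\<forall>I\<in>S. \<exists>m. cyclic_ideal m I \<and> int M < 2 * m \<and> m \<le> int M) \<longrightarrow> card S \<le> C * M"
proof -
  \<comment> \<open>This bounds the index of g R in \<open>I\<close>, since (3 K n)^D is at most (3
    K)^D M and \<open>M < 2 * m\<close>. The factorial \<open>F\<close> annihilates I / g R
    uniformly, whereas the multiplier from the preceding lemma depends on \<open>h\<close>.\<close>
  define L where "L = 2 * nat (3 * K) ^ D"
  define F where "F = (fact L :: int)"
  define C :: nat where "C = 3 ^ D * 2 ^ (nat F ^ D)"
  have "card S \<le> C * M" if M: "M \<ge> 1"
    and S: "\<forall>I\<in>S. \<exists>m. cyclic_ideal m I \<and> int M < 2 * m \<and> m \<le> int M" for M :: nat and S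
  proof -
    \<comment> \<open>The integer part of the \<open>D\<close>-th root of \<open>M\<close>:
      \<open>M < (n + 1) ^ D\<close> serves the pigeonhole, \<open>n ^ D \<le> M\<close> the count
      of the \<open>g\<close>.\<close>
    have "\<exists>n. n ^ D \<le> M \<and> M < (n + 1) ^ D"
    proof -
      define P where "P = (\<lambda>n::nat. n ^ D \<le> M)"
      have "P 0" using D_pos by (simp add: P_def power_0_left)
      moreover have "\<forall>n. P n \<longrightarrow> n \<le> M"
        using D_pos self_le_power[of _ D] by (metis P_def le_trans less_one linorder_not_le nat_le_linear)
      ultimately have "P (Greatest P)" "\<not> P (Greatest P + 1)"
        using GreatestI_nat[of P 0 M] Greatest_le_nat[of P "Greatest P + 1" M] by auto
      then show ?thesis by (auto simp: P_def not_le)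
    qed
    then obtain n where n: "n ^ D \<le> M" "M < (n + 1) ^ D" by blast
    have n1: "n \<ge> 1"
      using n(2) M by (cases n) auto
    define Q where "Q = (\<lambda>g. {I \<in> S. is_ideal I \<and> g \<in> I \<and> (\<forall>h\<in>I. of_int F * h \<in> (*) g ` R)})"
    have "S \<subseteq> (\<Union>g\<in>cube (int n) - {0}. Q g)"
    proof
      fix I assume "I \<in> S"
      then obtain m where m: "cyclic_ideal m I" "int M < 2 * m" "m \<le> int M"
        using S by blast
      have "m < (int n + 1) ^ D"
        using m(3) n(2) by (metis add.commute le_less_trans of_nat_1 of_nat_add of_nat_less_iff of_nat_power)
      then obtain g where g: "g \<in> I" "g \<noteq> 0" "g \<in> cube (int n)"
        using cyclic_ideal_small_element[OF m(1), of "int n"] by auto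
      have id: "is_ideal I"
        using m by (simp add: cyclic_ideal_def)
      have "nat (3 * K * int n) ^ D = nat (3 * K) ^ D * n ^ D"
        using K_ge by (simp add: nat_mult_distrib power_mult_distrib)
      also have "\<dots> \<le> nat (3 * K) ^ D * M"
        using n by simp
      also have "\<dots> \<le> nat (3 * K) ^ D * (2 * nat m)"
        using m by (intro mult_left_mono) auto
      also have "\<dots> < nat m * (L + 1)"
        using m by (simp add: L_def algebra_simps)
      finally have bound: "nat (3 * K * int n) ^ D < nat m * (L + 1)" .
      have "of_int F * h \<in> (*) g ` R" if h: "h \<in> I" for h
      proof -
        obtain k where k: "k \<in> {1..int L}" "of_int k * h \<in> (*) g ` R"
          using cyclic_ideal_multiple_principal[OF m(1) g _ bound h] n1 by fastforce
        have "k dvd F"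
        proof -
          obtain j where j: "k = int j" "1 \<le> j" "j \<le> L"
            using k by (metis atLeastAtMost_iff nonneg_int_cases of_nat_1 of_nat_le_iff order.trans zero_le_one)
          then have "int j dvd int (fact L)"
            unfolding int_dvd_int_iff by (intro dvd_fact)
          then show ?thesis by (simp add: F_def j)
        qed
        then obtain j where "F = j * k"
          by (metis dvdE mult.commute)
        then have "of_int F * h = of_int j * (of_int k * h)"
          by simp
        also have "\<dots> \<in> (*) g ` R"
          by (intro ideal_mult'[OF is_ideal_principal[OF ideal_R[OF id g(1)]] k(2)] of_int_R)
        finally show ?thesis .
      qed
      then show "I \<in> (\<Union>g\<in>cube (int n) - {0}. Q g)"
        using g id \<open>I \<in> S\<close> by (auto simp: Q_def)
    qed
    moreover have Q: "finite (Q g) \<and> card (Q g) \<le> 2 ^ (nat F ^ D)" if "g \<noteq> 0" for g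
      using that by (intro card_ideals_between[of g F]) (auto simp: Q_def F_def)
    ultimately have "card S \<le> card (\<Union>g\<in>cube (int n) - {0}. Q g)"
      by (intro card_mono) auto
    also have "\<dots> \<le> (\<Sum>g\<in>cube (int n) - {0}. card (Q g))"
      by (intro card_UN_le) auto
    also have "\<dots> \<le> card (cube (int n) - {0}) * 2 ^ (nat F ^ D)"
      using sum_bounded_above[of "cube (int n) - {0}" "\<lambda>g. card (Q g)" "2 ^ (nat F ^ D)"] Q by simp
    also have "\<dots> \<le> card (cube (int n)) * 2 ^ (nat F ^ D)"
      by (intro mult_right_mono card_mono) auto
    also have "\<dots> \<le> nat (3 * int n) ^ D * 2 ^ (nat F ^ D)"
      using n1 by (intro mult_right_mono card_cube') auto
    also have "\<dots> = C * n ^ D"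
      by (simp add: C_def nat_mult_distrib power_mult_distrib)
    also have "\<dots> \<le> C * M"
      using n by simp
    finally show ?thesis .
  qed
  then show ?thesis by blast
qed

subsection \<open>Maximal ideals\<close>

definition maximal_ideal :: "'a set \<Rightarrow> bool" where
  "maximal_ideal P \<longleftrightarrow> is_ideal P \<and> 1 \<notin> P \<and> (\<forall>J. is_ideal J \<and> P \<subseteq> J \<and> 1 \<notin> J \<longrightarrow> J = P)"

lemma maximal_ideal_is_ideal: "maximal_ideal P \<Longrightarrow> is_ideal P"
  and maximal_ideal_1: "maximal_ideal P \<Longrightarrow> 1 \<notin> P"
  by (auto simp: maximal_ideal_def)

text \<open>P + x R is an ideal strictly larger than \<open>P\<close>, so it contains 1.\<close>

lemma maximal_ideal_inverse:
  assumes P: "maximal_ideal P" and x: "x \<in> R" "x \<notin> P"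
  shows "\<exists>u\<in>R. 1 - x * u \<in> P"
proof -
  note id = maximal_ideal_is_ideal[OF P]
  define J where "J = {y + x * u | y u. y \<in> P \<and> u \<in> R}"
  have "is_ideal J"
    unfolding is_ideal_def
  proof (intro conjI ballI)
    show "J \<subseteq> R"
      using x ideal_R[OF id] by (auto simp: J_def intro!: zspan_add mult_R)
    show "0 \<in> J"
      unfolding J_def using ideal_0[OF id] by (intro CollectI exI[of _ 0]) auto
  next
    fix a b assume "a \<in> J" "b \<in> J"
    then obtain y u y' u' where e: "a = y + x * u" "b = y' + x * u'" "y \<in> P" "y' \<in> P" "u \<in> R" "u' \<in> R"
      by (auto simp: J_def)
    have "a - b = (y - y') + x * (u - u')"
      by (simp add: e algebra_simps)
    then show "a - b \<in> J"
      unfolding J_def using e ideal_diff[OF id] zspan_diff by blast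
  next
    fix a b assume "a \<in> J" "b \<in> R"
    then obtain y u where e: "a = y + x * u" "y \<in> P" "u \<in> R"
      by (auto simp: J_def)
    have "a * b = y * b + x * (u * b)"
      by (simp add: e algebra_simps)
    then show "a * b \<in> J"
      unfolding J_def using e ideal_mult[OF id] mult_R \<open>b \<in> R\<close> by blast
  qed
  moreover have "P \<subseteq> J"
  proof
    fix y assume "y \<in> P"
    then show "y \<in> J"
      unfolding J_def by (intro CollectI exI[of _ y] exI[of _ 0]) auto
  qed
  moreover have "x \<in> J"
    unfolding J_def using ideal_0[OF id] by (intro CollectI exI[of _ 0] exI[of _ 1]) auto
  ultimately have "1 \<in> J"
    using P x by (auto simp: maximal_ideal_def)
  then obtain y u where "1 = y + x * u" "y \<in> P" "u \<in> R"
    by (auto simp: J_def)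
  then show ?thesis
    by (metis add_diff_cancel_right')
qed

text \<open>An ideal containing \<open>g\<close> contains the positive integer \<open>N\<close>, so
  by \<open>card_ideals_between\<close> there are finitely many of them. A maximal one is found in
  this finite set, without Zorn's lemma.\<close>

lemma ex_maximal_ideal:
  assumes g: "g \<in> R" "g \<noteq> 0" and unit: "\<not> (\<exists>v\<in>R. g * v = 1)"
  shows "\<exists>P. maximal_ideal P \<and> g \<in> P"
proof -
  obtain s N where s: "s \<in> R" "N > 0" "g * s = of_int N"
    using ex_inverse g by blast
  define S where "S = {J. is_ideal J \<and> 1 \<notin> J \<and> g \<in> J}"
  have "finite S"
  proof (rule conjunct1[OF card_ideals_between[OF g(2) s(2)]])
    fix I assume I: "I \<in> S"
    have "of_int N * h \<in> (*) g ` R" if "h \<in> R" for h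
    proof (rule image_eqI)
      show "of_int N * h = g * (s * h)"
        by (simp add: s(3)[symmetric] mult.assoc)
    qed (intro mult_R s that)
    then show "is_ideal I \<and> g \<in> I \<and> (\<forall>h\<in>I. of_int N * h \<in> (*) g ` R)"
      using I ideal_R by (auto simp: S_def)
  qed
  moreover have "1 \<notin> (*) g ` R"
    using unit by force
  moreover have "g \<in> (*) g ` R"
    by (metis imageI mult_1_right one_R)
  ultimately have "(*) g ` R \<in> S"
    using is_ideal_principal g by (auto simp: S_def)
  with \<open>finite S\<close> obtain P where P: "P \<in> S" "\<forall>J\<in>S. P \<subseteq> J \<longrightarrow> J = P"
    using finite_has_maximal[of S] by (metis empty_iff)
  then have "maximal_ideal P"
    by (auto simp: maximal_ideal_def S_def)
  with P show ?thesis
    by (auto simp: S_def)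
qed

text \<open>\<open>P\<close> contains a positive integer, namely a multiple of \<open>g\<close>. The
  least one is prime because R / P is a field.\<close>

lemma maximal_ideal_ex_prime:
  assumes P: "maximal_ideal P" and g: "g \<in> P" "g \<noteq> 0"
  shows "\<exists>p::nat. prime p \<and> of_nat p \<in> P"
proof -
  note id = maximal_ideal_is_ideal[OF P]
  obtain s N where s: "s \<in> R" "N > 0" "g * s = of_int N"
    using ex_inverse g ideal_R[OF id] by blast
  then have "of_nat (nat N) \<in> P" "nat N > 0"
    using ideal_mult[OF id g(1) s(1)] by auto
  then have ex: "\<exists>m::nat. m > 0 \<and> of_nat m \<in> P"
    by blast
  define m where "m = (LEAST m::nat. m > 0 \<and> of_nat m \<in> P)"
  have m: "m > 0" "of_nat m \<in> P"
    using LeastI_ex[OF ex] by (auto simp: m_def)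
  have least: "m \<le> k" if "k > 0" "of_nat k \<in> P" for k
    unfolding m_def using that by (intro Least_le) auto
  have "m \<noteq> 1"
    using m maximal_ideal_1[OF P] by auto
  moreover have "a = 1 \<or> a = m" if dvd: "a dvd m" for a
  proof (rule ccontr)
    assume a: "\<not> (a = 1 \<or> a = m)"
    obtain b where b: "m = a * b"
      using dvd by blast
    have ab: "a > 0" "b > 0" "a < m" "b < m"
      using a b m by (auto intro!: Nat.gr0I)
    have "of_nat a \<notin> P"
      using least[OF ab(1)] ab(3) by (meson leD)
    have "of_nat b \<notin> P"
      using least[OF ab(2)] ab(4) by (meson leD)
    have aR: "of_nat k \<in> R" for k
      using of_int_R[of "int k"] by simp
    then obtain u where u: "u \<in> R" "1 - of_nat a * u \<in> P"
      using maximal_ideal_inverse[OF P _ \<open>of_nat a \<notin> P\<close>] by auto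
    \<comment> \<open>With \<open>u\<close> an inverse of \<open>a\<close> modulo \<open>P\<close>,
      the membership of \<open>m = a * b\<close> forces \<open>b\<close> into \<open>P\<close>,
      against minimality.\<close>
    have "of_nat b * (1 - of_nat a * u) + u * of_nat m \<in> P"
      using u m aR by (intro ideal_add[OF id] ideal_mult'[OF id])
    also have "of_nat b * (1 - of_nat a * u) + u * of_nat m = of_nat b"
      by (simp add: b algebra_simps)
    finally show False
      using \<open>of_nat b \<notin> P\<close> by contradiction
  qed
  ultimately have "prime m"
    using m by (auto simp: prime_nat_iff)
  with m show ?thesis by blast
qed

lemma of_int_ideal_imp_dvd:
  assumes id: "is_ideal P" and "1 \<notin> P" and p: "prime p" "of_nat p \<in> P" and k: "of_int k \<in> P"
  shows "int p dvd k"
proof (rule ccontr)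
  assume "\<not> int p dvd k"
  then have "coprime (int p) k"
    using p by (intro prime_imp_coprime) auto
  then obtain u v where "u * int p + v * k = 1"
    using bezout_int[of "int p" k] by auto
  then have "of_int u * of_nat p + of_int v * of_int k = (1 :: 'a)"
    by (metis of_int_1 of_int_add of_int_mult of_int_of_nat_eq)
  moreover have "of_int u * of_nat p + of_int v * of_int k \<in> P"
    using p k by (intro ideal_add[OF id] ideal_mult'[OF id] of_int_R)
  ultimately show False
    using assms by simp
qed

text \<open>A class modulo p R is determined by its coordinates modulo \<open>p\<close>.\<close>

lemma incongruent_mod_int_card_le:
  assumes p: "p > 0" and E: "incongruent ((*) (of_int p) ` R) E"
  shows "card E \<le> nat p ^ D"
proof -
  have "\<forall>x\<in>E. \<exists>c. x = zcomb B c"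
    using E by (auto simp: incongruent_def elim!: zspanE)
  then obtain c where c: "\<And>x. x \<in> E \<Longrightarrow> x = zcomb B (c x)"
    by metis
  define \<phi> where "\<phi> = (\<lambda>x. restrict (\<lambda>b. c x b mod p) B)"
  have "inj_on \<phi> E"
  proof (rule inj_onI)
    fix x y assume xy: "x \<in> E" "y \<in> E" "\<phi> x = \<phi> y"
    have "c x b - c y b = p * (c x b div p - c y b div p)" if "b \<in> B" for b
    proof -
      have "c x b mod p = c y b mod p"
        using fun_cong[OF xy(3), of b] that by (simp add: \<phi>_def)
      then show ?thesis
        by (metis add_diff_cancel_right mult_div_mod_eq right_diff_distrib')
    qed
    then have "zcomb B (c x) - zcomb B (c y) = of_int p * zcomb B (\<lambda>b. c x b div p - c y b div p)"
      unfolding zcomb_diff zcomb_scale by (intro zcomb_cong) auto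
    then have "x - y \<in> (*) (of_int p) ` R"
      using c xy by auto
    then show "x = y"
      using E xy by (auto simp: incongruent_def)
  qed
  then have "card E \<le> card (B \<rightarrow>\<^sub>E {0..<p})"
    using p fin by (intro card_inj_on_le[of \<phi>]) (auto simp: \<phi>_def intro!: finite_PiE)
  then show ?thesis
    using fin by (simp add: card_PiE)
qed

text \<open>Chinese remaindering: each \<open>Q\<close> contributes a factor \<open>x * u\<close>
  that lies in \<open>Q\<close>, where \<open>x\<close> is outside \<open>P\<close> and
  \<open>u\<close> inverts it modulo \<open>P\<close>.\<close>

lemma maximal_ideals_separate:
  assumes P: "maximal_ideal P" and "finite T" "\<And>Q. Q \<in> T \<Longrightarrow> maximal_ideal Q \<and> Q \<noteq> P"
  shows "\<exists>e\<in>R. 1 - e \<in> P \<and> (\<forall>Q\<in>T. e \<in> Q)"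
  using assms(2,3)
proof (induction T)
  case empty
  then show ?case
    using ideal_0[OF maximal_ideal_is_ideal[OF P]] by (intro bexI[of _ 1]) auto
next
  case (insert Q T)
  note id = maximal_ideal_is_ideal[OF P]
  obtain e where e: "e \<in> R" "1 - e \<in> P" "\<forall>Q\<in>T. e \<in> Q"
    using insert.IH insert.prems by blast
  have Q: "maximal_ideal Q" "Q \<noteq> P"
    using insert.prems by auto
  have "\<not> Q \<subseteq> P"
    using P Q unfolding maximal_ideal_def by metis
  then obtain x where x: "x \<in> Q" "x \<notin> P" by blast
  have xR: "x \<in> R"
    using x ideal_R[OF maximal_ideal_is_ideal[OF Q(1)]] by blast
  then obtain u where u: "u \<in> R" "1 - x * u \<in> P"
    using maximal_ideal_inverse[OF P _ x(2)] by blast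
  have "1 - e + e * (1 - x * u) \<in> P"
    using e u by (intro ideal_add[OF id] ideal_mult'[OF id])
  then have "1 - e * (x * u) \<in> P"
    by (simp add: algebra_simps)
  moreover have "e * (x * u) \<in> Q"
    using x u e by (intro ideal_mult'[OF maximal_ideal_is_ideal[OF Q(1)]] ideal_mult[OF maximal_ideal_is_ideal[OF Q(1)]])
  moreover have "e * (x * u) \<in> Q'" if "Q' \<in> T" for Q'
    using that e insert.prems xR u by (intro ideal_mult mult_R maximal_ideal_is_ideal) auto
  ultimately show ?case
    using e xR u by (intro bexI[of _ "e * (x * u)"] mult_R) auto
qed

text \<open>For a finite set \<open>S\<close> of such ideals, combinations of separating elements
  with coefficients below \<open>p\<close> give \<open>p ^ card S\<close> classes modulo p R, and
  there are at most \<open>p ^ D\<close>.\<close>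

lemma card_maximal_ideals_over_prime:
  assumes p: "prime p"
  shows "finite {P. maximal_ideal P \<and> of_nat p \<in> P} \<and> card {P. maximal_ideal P \<and> of_nat p \<in> P} \<le> D"
proof (rule finite_if_finite_subsets_card_bdd)
  fix S assume S: "S \<subseteq> {P. maximal_ideal P \<and> of_nat p \<in> P}" "finite S"
  have "\<forall>P\<in>S. \<exists>e\<in>R. 1 - e \<in> P \<and> (\<forall>Q\<in>S - {P}. e \<in> Q)"
    using S by (intro ballI maximal_ideals_separate) auto
  then obtain e where e: "\<And>P. P \<in> S \<Longrightarrow> e P \<in> R" "\<And>P. P \<in> S \<Longrightarrow> 1 - e P \<in> P"
      "\<And>P Q. P \<in> S \<Longrightarrow> Q \<in> S \<Longrightarrow> P \<noteq> Q \<Longrightarrow> e P \<in> Q"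
    by (metis Diff_iff singletonD)
  have p0: "int p > 0"
    using p prime_gt_0_nat by simp
  define val where "val = (\<lambda>c. \<Sum>P\<in>S. of_int (c P) * e P)"
  define Z where "Z = S \<rightarrow>\<^sub>E {0..<int p}"
  have key: "c = d" if cd: "c \<in> Z" "d \<in> Z" "val c - val d \<in> (*) (of_int (int p)) ` R" for c d
    using cd(1,2) unfolding Z_def
  proof (rule PiE_ext)
    fix P assume P: "P \<in> S"
    then have mP: "maximal_ideal P" "of_nat p \<in> P"
      using S by auto
    note id = maximal_ideal_is_ideal[OF mP(1)]
    have sum_P: "sum h T \<in> P" if "\<And>Q. Q \<in> T \<Longrightarrow> h Q \<in> P" for h and T :: "'a set set"
      using that by (induction T rule: infinite_finite_induct) (auto intro: ideal_0[OF id] ideal_add[OF id])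
    have "val c - val d = (\<Sum>Q\<in>S. of_int (c Q - d Q) * e Q)"
      by (simp add: val_def sum_subtractf algebra_simps)
    also have "\<dots> = of_int (c P - d P) * e P + (\<Sum>Q\<in>S - {P}. of_int (c Q - d Q) * e Q)"
      by (rule sum.remove) (use S P in auto)
    finally have "of_int (c P - d P) = (val c - val d) - (\<Sum>Q\<in>S - {P}. of_int (c Q - d Q) * e Q)
        + of_int (c P - d P) * (1 - e P)"
      by (simp add: algebra_simps)
    also have "\<dots> \<in> P"
    proof (rule ideal_add[OF id ideal_diff[OF id]])
      show "val c - val d \<in> P"
        using cd(3) ideal_principal_subset[OF id mP(2)] by auto
      show "(\<Sum>Q\<in>S - {P}. of_int (c Q - d Q) * e Q) \<in> P"
        using e(3) P by (intro sum_P ideal_mult'[OF id] of_int_R) blast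
      show "of_int (c P - d P) * (1 - e P) \<in> P"
        using e(2) P by (intro ideal_mult'[OF id] of_int_R) blast
    qed
    finally have "int p dvd c P - d P"
      by (rule of_int_ideal_imp_dvd[OF id maximal_ideal_1[OF mP(1)] p mP(2)])
    moreover have "c P \<in> {0..<int p}" "d P \<in> {0..<int p}"
      using cd P by (auto simp: Z_def)
    then have "\<bar>c P - d P\<bar> < int p" by auto
    ultimately show "c P = d P"
      using dvd_imp_le_int[of "c P - d P" "int p"] by (cases "c P = d P") simp_all
  qed
  have pR: "is_ideal ((*) (of_int (int p)) ` R)"
    by (intro is_ideal_principal of_int_R)
  have "inj_on val Z"
    using ideal_0[OF pR] by (intro inj_onI key) simp_all
  moreover have "incongruent ((*) (of_int (int p)) ` R) (val ` Z)"
    unfolding incongruent_def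
  proof (intro conjI ballI impI)
    show "val ` Z \<subseteq> R"
      using e by (auto simp: val_def intro!: zspan_sum mult_R)
    show "finite (val ` Z)"
      using S by (auto simp: Z_def intro!: finite_PiE)
  next
    fix x y assume "x \<in> val ` Z" "y \<in> val ` Z" "x - y \<in> (*) (of_int (int p)) ` R"
    then show "x = y"
      using key by blast
  qed
  then have "card (val ` Z) \<le> nat (int p) ^ D"
    by (rule incongruent_mod_int_card_le[OF p0])
  ultimately have "p ^ card S \<le> p ^ D"
    using S by (simp add: card_image Z_def card_PiE)
  then show "card S \<le> D"
    using p prime_gt_1_nat power_le_imp_le_exp by blast
qed

text \<open>Some prime ideal over \<open>p\<close> has residue ring Z/p, that is, residue degree
  one.\<close>

definition degree_one_prime :: "nat \<Rightarrow> bool" where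
  "degree_one_prime p \<longleftrightarrow> prime p \<and>
     (\<exists>P. is_ideal P \<and> of_nat p \<in> P \<and> 1 \<notin> P \<and> (\<forall>x\<in>R. \<exists>k. x - of_int k \<in> P))"

text \<open>A lower bound for the index of any maximal ideal containing \<open>p\<close>.\<close>

definition min_index :: "nat \<Rightarrow> nat" where
  "min_index p = (if degree_one_prime p then p else p ^ 2)"

text \<open>The integers below \<open>p\<close> are always incongruent. If \<open>p\<close> is not
  of degree one, some \<open>\<theta>\<close> is congruent to no integer modulo \<open>P\<close>,
  and the \<open>i + j * \<theta>\<close> with \<open>i\<close> and \<open>j\<close> below
  \<open>p\<close> give \<open>p ^ 2\<close> classes.\<close>

lemma maximal_ideal_ex_incongruent:
  assumes P: "maximal_ideal P" and p: "prime p" "of_nat p \<in> P"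
  shows "\<exists>E. incongruent P E \<and> card E = min_index p"
proof -
  note id = maximal_ideal_is_ideal[OF P]
  note dvd = of_int_ideal_imp_dvd[OF id maximal_ideal_1[OF P] p]
  have small: "i = j" if "of_int (i - j) \<in> P" "i \<in> {0..<int p}" "j \<in> {0..<int p}" for i j
  proof -
    have "int p dvd i - j" by (rule dvd) fact
    moreover have "\<bar>i - j\<bar> < int p" using that by auto
    ultimately show ?thesis
      using dvd_imp_le_int[of "i - j" "int p"] by (cases "i = j") simp_all
  qed
  show ?thesis
  proof (cases "degree_one_prime p")
    case True
    have "incongruent P (of_int ` {0..<int p})"
      using small by (auto simp: incongruent_def simp flip: of_int_diff)
    moreover have "card (of_int ` {0..<int p} :: 'a set) = p"
      by (subst card_image) (auto intro: inj_onI)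
    ultimately show ?thesis
      using True by (auto simp: min_index_def)
  next
    case False
    then obtain \<theta> where \<theta>: "\<theta> \<in> R" "\<And>k. \<theta> - of_int k \<notin> P"
      using p id maximal_ideal_1[OF P] by (auto simp: degree_one_prime_def)
    define \<psi> where "\<psi> = (\<lambda>(i, j). of_int i + of_int j * \<theta> :: 'a)"
    define Z where "Z = {0..<int p} \<times> {0..<int p}"
    have key: "u = v" if uv: "u \<in> Z" "v \<in> Z" "\<psi> u - \<psi> v \<in> P" for u v
    proof -
      obtain i j i' j' where e: "u = (i, j)" "v = (i', j')"
        by fastforce
      have P0: "of_int (i - i') + of_int (j - j') * \<theta> \<in> P"
        using uv(3) by (simp add: \<psi>_def e algebra_simps)
      have "j = j'"
      proof (rule ccontr)
        assume "j \<noteq> j'"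
        have "\<not> int p dvd j - j'"
        proof
          assume "int p dvd j - j'"
          moreover have "\<bar>j - j'\<bar> < int p" using uv by (auto simp: e Z_def)
          ultimately show False
            using dvd_imp_le_int[of "j - j'" "int p"] \<open>j \<noteq> j'\<close> by simp
        qed
        then have "coprime (int p) (j - j')"
          using p by (intro prime_imp_coprime) auto
        \<comment> \<open>An inverse of \<open>j - j'\<close> modulo \<open>p\<close> would solve
          for \<open>\<theta>\<close> and make it congruent to an integer.\<close>
        then obtain a b where ab: "a * int p + b * (j - j') = 1"
          using bezout_int[of "int p" "j - j'"] by auto
        have "of_int (a * int p) * \<theta> + of_int b * (of_int (i - i') + of_int (j - j') * \<theta>) \<in> P"
        proof (intro ideal_add[OF id] ideal_mult'[OF id P0] of_int_R)
          have "of_int a * \<theta> * of_nat p \<in> P"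
            using p \<theta> by (intro ideal_mult'[OF id] mult_R of_int_R)
          then show "of_int (a * int p) * \<theta> \<in> P"
            by (simp add: mult_ac)
        qed
        also have "of_int (a * int p) * \<theta> + of_int b * (of_int (i - i') + of_int (j - j') * \<theta>)
            = of_int (a * int p + b * (j - j')) * \<theta> - of_int (- b * (i - i'))"
          by (simp add: algebra_simps)
        finally show False
          using \<theta>(2) by (simp only: ab of_int_1 mult_1)
      qed
      moreover from this have "of_int (i - i') \<in> P"
        using P0 by (simp del: of_int_diff)
      then have "i = i'"
        using uv by (intro small) (auto simp: e Z_def)
      ultimately show ?thesis by (simp add: e)
    qed
    have "inj_on \<psi> Z"
      using ideal_0[OF id] by (intro inj_onI key) simp_all
    then have "card (\<psi> ` Z) = min_index p"
      using False by (simp add: card_image Z_def card_cartesian_product min_index_def power2_eq_square)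
    moreover have "incongruent P (\<psi> ` Z)"
      unfolding incongruent_def
    proof (intro conjI ballI impI)
      show "\<psi> ` Z \<subseteq> R"
        by (auto simp: \<psi>_def intro!: zspan_add mult_R \<theta>)
      show "finite (\<psi> ` Z)"
        by (simp add: Z_def)
    next
      fix x y assume "x \<in> \<psi> ` Z" "y \<in> \<psi> ` Z" "x - y \<in> P"
      then show "x = y"
        using key by blast
    qed
    ultimately show ?thesis by blast
  qed
qed

subsection \<open>Primes of degree one\<close>

text \<open>The rational part dominates, so a coordinate of the product with any nonzero \<open>v\<close> is too large.\<close>

lemma shifted_not_unit:
  assumes n: "n \<ge> 1" and W: "W \<ge> 1" and y: "y \<in> cube n" and v: "v \<in> R"
  shows "(1 + of_int W * (of_int (K * n + 1) + y)) * v \<noteq> 1"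
proof
  assume eq: "(1 + of_int W * (of_int (K * n + 1) + y)) * v = 1"
  obtain d where d: "v = zcomb B d"
    using v by (rule zspanE)
  define m where "m = Max ((\<lambda>b. \<bar>d b\<bar>) ` B)"
  have "m \<in> (\<lambda>b. \<bar>d b\<bar>) ` B"
    unfolding m_def using fin one by (intro Max_in) auto
  then obtain b where b: "b \<in> B" "m = \<bar>d b\<bar>" by auto
  have v_cube: "v \<in> cube m"
    unfolding d m_def by (intro cubeI Max_ge finite_imageI fin imageI)
  have "m \<noteq> 0"
  proof
    assume "m = 0"
    then have "v = 0" using v_cube cube_0 by blast
    with eq show False by simp
  qed
  with b have m: "m \<ge> 1" by simp
  have "y * v \<in> cube (K * n * m)"
    using y v_cube n m by (intro cube_mult) auto
  then have "1 - of_int W * (y * v) \<in> cube (1 + \<bar>W\<bar> * (K * n * m))"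
    using of_int_cube[of 1] by (intro cube_diff cube_scale) auto
  also have "1 - of_int W * (y * v) = of_int (1 + W * (K * n + 1)) * v"
    using eq by (simp add: algebra_simps)
  also have "\<dots> = zcomb B (\<lambda>b. (1 + W * (K * n + 1)) * d b)"
    unfolding d zcomb_scale ..
  finally have "\<bar>(1 + W * (K * n + 1)) * d b\<bar> \<le> 1 + \<bar>W\<bar> * (K * n * m)"
    using b by (intro cube_zcombD)
  moreover have "K * n \<ge> 0" using K_ge n by simp
  then have "\<bar>1 + W * (K * n + 1)\<bar> = 1 + W * (K * n + 1)"
    using W by simp
  ultimately have "(1 + W * (K * n + 1)) * m \<le> 1 + W * (K * n * m)"
    using b W by (simp add: abs_mult)
  then have "(1 + W) * m \<le> 1"
    by (simp add: algebra_simps)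
  moreover have "(1 + W) * m \<ge> (1 + 1) * 1"
    using W m by (intro mult_mono) auto
  ultimately show False by simp
qed

lemma shifted_cube:
  assumes n: "n \<ge> 1" and W: "W \<ge> 1" and y: "y \<in> cube n"
  shows "1 + of_int W * (of_int (K * n + 1) + y) \<in> cube (4 * K * W * n)"
proof (rule cube_mono)
  have K: "K * n \<ge> 1 * 1" using K_ge n by (intro mult_mono) auto
  have "of_int 1 + of_int W * (of_int (K * n + 1) + y) \<in> cube (\<bar>1\<bar> + \<bar>W\<bar> * (\<bar>K * n + 1\<bar> + n))"
    by (intro cube_add cube_scale of_int_cube y)
  then show "1 + of_int W * (of_int (K * n + 1) + y) \<in> cube (1 + W * (K * n + 1 + n))"
    using K W by simp
  have "1 * 1 \<le> W * (K * n)" "W * 1 \<le> W * (K * n)" "W * (1 * n) \<le> W * (K * n)"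
    using K W K_ge n by (intro mult_mono; simp)+
  then show "1 + W * (K * n + 1 + n) \<le> 4 * K * W * n"
    by (simp add: algebra_simps)
qed

text \<open>An ideal of large index has no short nonzero elements, by
  \<open>incongruent_card_le\<close> read backwards. The case \<open>s = 0\<close> is separate
  because that lemma asks for size at least 1.\<close>

lemma ideal_cube_trivial:
  assumes I: "is_ideal I" and E: "incongruent I E" and s: "s = 0 \<or> nat (3 * K * int s) ^ D < card E"
  shows "I \<inter> cube (int s) \<subseteq> {0}"
proof (cases "s = 0")
  case True
  then show ?thesis using cube_0 by auto
next
  case False
  show ?thesis
  proof
    fix g assume g: "g \<in> I \<inter> cube (int s)"
    show "g \<in> {0}"
      using incongruent_card_le[OF I _ _ _ _ E, of g "int s"] g s False by (cases "g = 0") auto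
  qed
qed

text \<open>The sieve estimate for one ideal. If \<open>P\<close> has no nonzero element of size at
  most \<open>s\<close>, each cell of side \<open>s + 1\<close> contains at most one point of
  \<open>X\<close>. With \<open>s\<close> as large as the index allows, this gives the density 1 /
  \<open>card E\<close> up to a constant, unless one cell covers the whole box.\<close>

lemma card_box_ideal:
  fixes n :: nat and T W :: int
  assumes P: "is_ideal P" "1 \<notin> P" and p: "prime p" "of_nat p \<in> P" and W: "\<not> int p dvd W"
    and E: "incongruent P E" "E \<noteq> {}" and n: "n \<ge> 1"
  defines "X \<equiv> {c \<in> B \<rightarrow>\<^sub>E {0..<int n}. 1 + of_int W * (of_int T + zcomb B c) \<in> P}"
  shows "card X * card E \<le> nat (6 * K * int n) ^ D \<or> (card X \<le> 1 \<and> n ^ D < card E)"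
proof -
  define k where "k = nat (3 * K)"
  have k: "nat (3 * K * int s) = k * s" for s
    using K_ge by (simp add: k_def nat_mult_distrib)
  have k1: "k \<ge> 1" using K_ge by (simp add: k_def)
  \<comment> \<open>The greatest \<open>s\<close> with this property also bounds
    \<open>card E\<close> from above, by \<open>(k * (s + 1)) ^ D\<close>.\<close>
  define A where "A = (\<lambda>s. (k * s) ^ D < card E)"
  have "A 0"
    using E D_pos by (simp add: A_def power_0_left incongruent_def card_gt_0_iff)
  have "\<forall>s. A s \<longrightarrow> s \<le> card E"
  proof (intro allI impI)
    fix s assume "A s"
    have "s \<le> k * s" using k1 by simp
    also have "\<dots> \<le> (k * s) ^ D"
    proof -
      have "m \<le> m ^ D" for m :: nat
        using D_pos by (cases m) (auto intro!: self_le_power)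
      then show ?thesis .
    qed
    finally show "s \<le> card E" using \<open>A s\<close> by (simp add: A_def)
  qed
  with \<open>A 0\<close> have "A (Greatest A)" "\<not> A (Greatest A + 1)"
    using GreatestI_nat[of A 0 "card E"] Greatest_le_nat[of A "Greatest A + 1" "card E"] by auto
  then obtain s where s: "(k * s) ^ D < card E" "card E \<le> (k * (s + 1)) ^ D"
    by (auto simp: A_def not_less)
  have triv: "P \<inter> cube (int s) \<subseteq> {0}"
    by (rule ideal_cube_trivial[OF P(1) E(1)]) (use s in \<open>simp add: k\<close>)
  define m where "m = int s + 1"
  define \<phi> where "\<phi> = (\<lambda>c. restrict (\<lambda>b. c b div m) B)"
  have "inj_on \<phi> X"
  proof (rule inj_onI)
    fix c d assume cd: "c \<in> X" "d \<in> X" "\<phi> c = \<phi> d"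
    have "(1 + of_int W * (of_int T + zcomb B c)) - (1 + of_int W * (of_int T + zcomb B d)) \<in> P"
      using cd by (intro ideal_diff[OF P(1)]) (auto simp: X_def)
    then have WP: "of_int W * (zcomb B c - zcomb B d) \<in> P"
      by (simp add: algebra_simps)
    \<comment> \<open>\<open>W\<close> is invertible modulo \<open>p\<close>, so it can be cancelled
      from the congruence modulo \<open>P\<close>.\<close>
    have "coprime (int p) W"
      using p W by (intro prime_imp_coprime) auto
    then obtain u v where "u * int p + v * W = 1"
      using bezout_int[of "int p" W] by auto
    then have uv: "of_int u * of_nat p + of_int v * of_int W = (1 :: 'a)"
      by (metis of_int_1 of_int_add of_int_mult of_int_of_nat_eq)
    have "of_int u * (of_nat p * (zcomb B c - zcomb B d)) + of_int v * (of_int W * (zcomb B c - zcomb B d)) \<in> P"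
      by (rule ideal_add[OF P(1)]; rule ideal_mult'[OF P(1)])
        (use p WP in \<open>auto intro!: ideal_mult[OF P(1)] zspan_diff\<close>)
    also have "of_int u * (of_nat p * (zcomb B c - zcomb B d)) + of_int v * (of_int W * (zcomb B c - zcomb B d))
        = (of_int u * of_nat p + of_int v * of_int W) * (zcomb B c - zcomb B d)"
      by (simp add: algebra_simps)
    finally have "zcomb B c - zcomb B d \<in> P"
      by (simp add: uv)
    moreover have "zcomb B c - zcomb B d \<in> cube (int s)"
      unfolding zcomb_diff
    proof (rule cubeI)
      fix b assume b: "b \<in> B"
      have "c b div m = d b div m"
        using fun_cong[OF cd(3), of b] b by (simp add: \<phi>_def)
      then have "c b - d b = c b mod m - d b mod m"
        by (metis add_diff_cancel_left mult_div_mod_eq)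
      moreover have "c b mod m \<in> {0..int s}" "d b mod m \<in> {0..int s}"
        using pos_mod_bound[of m "c b"] pos_mod_bound[of m "d b"] by (auto simp: m_def)
      ultimately show "\<bar>c b - d b\<bar> \<le> int s" by auto
    qed
    ultimately have "zcomb B c = zcomb B d"
      using triv by auto
    then show "c = d"
      using cd zcomb_inj_on_PiE[of "{0..<int n}"] by (auto simp: X_def inj_on_def)
  qed
  moreover have "\<phi> ` X \<subseteq> B \<rightarrow>\<^sub>E {0..int n div m}"
  proof
    fix e assume "e \<in> \<phi> ` X"
    then obtain c where c: "c \<in> B \<rightarrow>\<^sub>E {0..<int n}" "e = \<phi> c"
      by (auto simp: X_def)
    have "c b div m \<in> {0..int n div m}" if "b \<in> B" for b
    proof -
      have "c b \<in> {0..<int n}" using c that by auto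
      then show ?thesis
        using zdiv_mono1[of "c b" "int n" m] by (simp add: m_def pos_imp_zdiv_nonneg_iff)
    qed
    then show "e \<in> B \<rightarrow>\<^sub>E {0..int n div m}"
      by (auto simp: c(2) \<phi>_def)
  qed
  ultimately have "card X \<le> card (B \<rightarrow>\<^sub>E {0..int n div m})"
    using fin by (intro card_inj_on_le[of \<phi>] finite_PiE) auto
  also have "\<dots> = (n div (s + 1) + 1) ^ D"
  proof -
    have "int n div m = int (n div (s + 1))"
      by (simp add: m_def zdiv_int add.commute)
    then show ?thesis using fin by (simp add: card_PiE nat_add_distrib)
  qed
  finally have cX: "card X \<le> (n div (s + 1) + 1) ^ D" .
  show ?thesis
  proof (cases "s + 1 \<le> n")
    case True
    \<comment> \<open>The partial cells at the border cost at most a factor 2 as long as a cell fits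
      into the box.\<close>
    have "(n div (s + 1) + 1) * (s + 1) \<le> 2 * n"
      using True div_times_less_eq_dividend[of n "s + 1"] unfolding add_mult_distrib mult_1 by linarith
    then have "(n div (s + 1) + 1) * (k * (s + 1)) \<le> k * (2 * n)"
      by (metis mult.left_commute mult_le_mono2)
    then have "((n div (s + 1) + 1) * (k * (s + 1))) ^ D \<le> (k * (2 * n)) ^ D"
      by (rule power_mono) simp
    moreover have "card X * card E \<le> (n div (s + 1) + 1) ^ D * (k * (s + 1)) ^ D"
      using cX s by (intro mult_mono) auto
    moreover have "k * (2 * n) = nat (6 * K * int n)"
      using K_ge by (simp add: k_def nat_mult_distrib)
    ultimately show ?thesis
      by (metis order.trans power_mult_distrib)
  next
    case False
    then have "n ^ D \<le> (k * s) ^ D"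
      using k1 by (intro power_mono) (auto intro: order.trans[of _ "1 * s"] mult_mono)
    with s cX False show ?thesis by auto
  qed
qed

lemma min_index_pos: "prime p \<Longrightarrow> min_index p > 0"
  by (auto simp: min_index_def prime_gt_0_nat)

lemma min_index_bounds: "prime p \<Longrightarrow> p \<le> min_index p \<and> min_index p \<le> p ^ 2"
  by (auto simp: min_index_def self_le_power prime_gt_0_nat Suc_leI power2_nat_le_eq_le)

text \<open>Up to a constant, a bound for the proportion of a box lost to one maximal ideal over
  \<open>p\<close>.\<close>

definition prime_weight :: "nat \<Rightarrow> real" where
  "prime_weight p = (if prime p then 1 / real (min_index p) else 0)"

lemma prime_weight_nonneg: "prime_weight p \<ge> 0"
  by (simp add: prime_weight_def)

text \<open>Convergence would pass to \<open>prime_weight\<close>, whose values at the remaining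
  primes are at most 1/p^2. Then the maximal ideals would cover less than a suitable shifted box,
  although each of its elements is a nonunit and so lies in one of them.\<close>

theorem not_summable_degree_one_primes:
  "\<not> summable (\<lambda>p. if degree_one_prime p then 1 / real p else 0)"
proof
  assume "summable (\<lambda>p. if degree_one_prime p then 1 / real p else 0)"
  moreover have "summable (\<lambda>p::nat. 1 / real p ^ 2)"
    using inverse_power_summable[of 2, where 'a = real] by (simp only: inverse_eq_divide order_refl)
  ultimately have "summable (\<lambda>p. (if degree_one_prime p then 1 / real p else 0) + 1 / real p ^ 2)"
    by (rule summable_add)
  then have "summable prime_weight"
    by (rule summable_comparison_test'[of _ 0]) (auto simp: prime_weight_def min_index_def)
  have tail: "\<exists>N. \<forall>S. finite S \<and> S \<subseteq> {N<..} \<longrightarrow> sum prime_weight S < e" if "e > 0" for e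
  proof -
    have "\<exists>N. \<forall>m\<ge>N. \<forall>n. norm (sum prime_weight {m..<n}) < e"
      using \<open>summable prime_weight\<close> that by (simp only: summable_Cauchy)
    then obtain N where N: "\<forall>m\<ge>N. \<forall>n. norm (sum prime_weight {m..<n}) < e"
      by blast
    have "sum prime_weight S < e" if S: "finite S" "S \<subseteq> {N<..}" for S
    proof -
      have "sum prime_weight S \<le> sum prime_weight {N..<Suc (Max (insert 0 S))}"
        using S prime_weight_nonneg by (intro sum_mono2) (auto simp: less_Suc_eq_le)
      also have "\<dots> < e" using N by (metis order_refl abs_ge_self order.strict_trans1 real_norm_def)
      finally show ?thesis .
    qed
    then show ?thesis by blast
  qed
  \<comment> \<open>\<open>a\<close> and, below, \<open>a'\<close> are the costs per unit of
    \<open>prime_weight\<close>, relative to \<open>n ^ D\<close>, of the two cases of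
    \<open>card_box_ideal\<close>, for up to \<open>D\<close> ideals over each prime. The tails are
    cut so that each case costs less than a third of the box.\<close>
  define a where "a = real (nat (6 * K)) ^ D * real D"
  have a: "a > 0"
    using K_ge D_pos by (simp add: a_def)
  obtain z where z: "\<And>S. finite S \<Longrightarrow> S \<subseteq> {z<..} \<Longrightarrow> sum prime_weight S < 1 / (3 * a)"
    using tail[of "1 / (3 * a)"] a by auto
  \<comment> \<open>This makes every \<open>g c\<close> congruent to 1 modulo all primes up to
    \<open>z\<close>, so these primes drop out of the sieve.\<close>
  define W where "W = (fact z :: int)"
  have W: "W \<ge> 1" by (simp add: W_def fact_ge_1)
  \<comment> \<open>Elements of \<open>cube (4 * K * W * n)\<close> only lie in ideals of index at
    most (3 K)^D (4 K W n)^D, which is \<open>(k * n) ^ D\<close>.\<close>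
  define k where "k = nat (12 * K ^ 2 * W)"
  have k: "k > 0" using K_ge W by (simp add: k_def)
  define a' where "a' = real k ^ D * real D"
  have a': "a' > 0"
    using k D_pos by (simp add: a'_def)
  obtain z' where z': "\<And>S. finite S \<Longrightarrow> S \<subseteq> {z'<..} \<Longrightarrow> sum prime_weight S < 1 / (3 * a')"
    using tail[of "1 / (3 * a')"] a' by auto
  \<comment> \<open>In the exceptional case \<open>n ^ D < min_index p \<le> p ^ 2\<close>, so the
    square forces \<open>p > z'\<close>.\<close>
  define n where "n = (z' + 1) ^ 2"
  have n: "n \<ge> 1" by (simp add: n_def)
  define T where "T = K * int n + 1"
  define g where "g = (\<lambda>c. 1 + of_int W * (of_int T + zcomb B c))"
  define Box where "Box = B \<rightarrow>\<^sub>E {0..<int n}"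
  define X where "X = (\<lambda>P. {c \<in> Box. g c \<in> P})"
  define Mx where "Mx = (\<lambda>p. {P. maximal_ideal P \<and> of_nat p \<in> P})"
  define Pr where "Pr = {p. prime p \<and> z < p \<and> p \<le> (k * n) ^ D}"
  have finPr: "finite Pr"
    unfolding Pr_def by (rule finite_subset[of _ "{..(k * n) ^ D}"]) auto
  have Mx: "finite (Mx p) \<and> card (Mx p) \<le> D" if "p \<in> Pr" for p
    using card_maximal_ideals_over_prime that by (auto simp: Mx_def Pr_def)
  have finBox: "finite Box"
    unfolding Box_def using fin by (intro finite_PiE) auto
  have c_cube: "zcomb B c \<in> cube (int n)" if "c \<in> Box" for c
    using that by (intro cubeI) (fastforce simp: Box_def PiE_iff)
  have gR: "g c \<in> R" for c
    unfolding g_def by (intro zspan_add mult_R) auto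
  have g0: "g c \<noteq> 0" if "c \<in> Box" for c
  proof
    assume "g c = 0"
    \<comment> \<open>The coordinate at the basis element 1 is positive on the box.\<close>
    also have "g c = of_int (1 + W * T) + of_int W * zcomb B c"
      by (simp add: g_def algebra_simps)
    also have "\<dots> = zcomb B (\<lambda>b. (if b = 1 then 1 + W * T else 0) + W * c b)"
      unfolding of_int_eq_zcomb[of "1 + W * T"] zcomb_scale zcomb_add ..
    finally have "1 + W * T + W * c 1 = 0"
      using indep[OF _ one] by fastforce
    moreover have "T \<ge> 0" "c 1 \<ge> 0"
      using K_ge that one by (auto simp: T_def Box_def PiE_iff)
    then have "W * T \<ge> 0" "W * c 1 \<ge> 0"
      using W by simp_all
    ultimately show False by simp
  qed
  have index: "min_index p \<le> (k * n) ^ D"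
    if P: "maximal_ideal P" "prime p" "of_nat p \<in> P" and c: "c \<in> X P" for P p c
  proof -
    obtain E where E: "incongruent P E" "card E = min_index p"
      using maximal_ideal_ex_incongruent P by blast
    have "g c \<in> cube (4 * K * W * int n)"
      unfolding g_def T_def using c n W by (intro shifted_cube c_cube) (auto simp: X_def)
    moreover have "4 * K * W * int n \<ge> 1 * 1 * 1 * 1"
      using K_ge W n by (intro mult_mono) auto
    ultimately have "min_index p \<le> nat (3 * K * (4 * K * W * int n)) ^ D"
      unfolding E(2)[symmetric]
      using c g0 by (intro incongruent_card_le[OF maximal_ideal_is_ideal[OF P(1)] _ _ _ _ E(1), of "g c"]) (auto simp: X_def)
    also have "nat (3 * K * (4 * K * W * int n)) = k * n"
      unfolding k_def using K_ge W
      by (subst nat_mult_distrib [symmetric, where z' = "int n", simplified nat_int]) (auto simp: power2_eq_square mult_ac)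
    finally show ?thesis .
  qed
  have cover: "Box \<subseteq> (\<Union>p\<in>Pr. \<Union>P\<in>Mx p. X P)"
  proof
    fix c assume c: "c \<in> Box"
    have "\<not> (\<exists>v\<in>R. g c * v = 1)"
      unfolding g_def T_def using shifted_not_unit[of "int n" W "zcomb B c"] c_cube[OF c] n W by auto
    then obtain P where P: "maximal_ideal P" "g c \<in> P"
      using ex_maximal_ideal gR g0[OF c] by blast
    then obtain p where p: "prime p" "of_nat p \<in> P"
      using maximal_ideal_ex_prime g0[OF c] by blast
    have cX: "c \<in> X P" using P c by (simp add: X_def)
    have "\<not> p \<le> z"
    proof
      assume "p \<le> z"
      then have "int p dvd int (fact z)"
        unfolding int_dvd_int_iff using p prime_gt_0_nat[of p] by (intro dvd_fact) auto
      then obtain w where w: "W = int p * w"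
        by (auto simp: W_def)
      note id = maximal_ideal_is_ideal[OF P(1)]
      have "g c - of_nat p * (of_int w * (of_int T + zcomb B c)) \<in> P"
        using P p by (intro ideal_diff[OF id] ideal_mult[OF id] mult_R zspan_add) auto
      then show False
        using maximal_ideal_1[OF P(1)] by (simp add: g_def w algebra_simps)
    qed
    moreover have "p \<le> (k * n) ^ D"
      using index[OF P(1) p cX] min_index_bounds[OF p(1)] by linarith
    ultimately show "c \<in> (\<Union>p\<in>Pr. \<Union>P\<in>Mx p. X P)"
      using P p cX by (auto simp: Pr_def Mx_def)
  qed
  \<comment> \<open>The first summand is the regular sieve bound. The second pays for ideals that
    meet the box in a single point: there \<open>min_index p \<le> (k * n) ^ D\<close>, so the
    summand is at least 1.\<close>
  define w' where "w' = (\<lambda>p. real n ^ D * (real (nat (6 * K)) ^ D * prime_weight p) +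
      real n ^ D * (real k ^ D * (if p > z' then prime_weight p else 0)))"
  have cX: "real (card (X P)) \<le> w' p" if p: "p \<in> Pr" and P: "P \<in> Mx p" for p P
  proof (cases "X P = {}")
    case True
    then show ?thesis
      by (auto simp: w'_def prime_weight_nonneg)
  next
    case False
    have mP: "maximal_ideal P" "prime p" "of_nat p \<in> P"
      using p P by (auto simp: Pr_def Mx_def)
    obtain E where E: "incongruent P E" "card E = min_index p"
      using maximal_ideal_ex_incongruent mP by blast
    have q: "real (min_index p) > 0" "prime_weight p = 1 / real (min_index p)"
      using min_index_pos mP by (auto simp: prime_weight_def)
    have "\<not> p dvd fact z"
      using p mP prime_dvd_fact_iff[of p z] by (auto simp: Pr_def)
    then have pW: "\<not> int p dvd W"
      unfolding W_def by (metis int_dvd_int_iff of_nat_fact)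
    have "E \<noteq> {}"
      using E(2) min_index_pos[OF mP(2)] by (metis card.empty less_irrefl)
    from card_box_ideal[OF maximal_ideal_is_ideal[OF mP(1)] maximal_ideal_1[OF mP(1)] mP(2,3) pW E(1) this n, of T]
    consider "card (X P) * min_index p \<le> nat (6 * K * int n) ^ D" | "card (X P) \<le> 1" "n ^ D < min_index p"
      unfolding X_def g_def Box_def E(2) by blast
    then show ?thesis
    proof cases
      case 1
      then have "real (card (X P) * min_index p) \<le> real (nat (6 * K * int n) ^ D)"
        by (rule of_nat_mono)
      also have "real (nat (6 * K * int n) ^ D) = real n ^ D * real (nat (6 * K)) ^ D"
        using K_ge by (simp add: nat_mult_distrib power_mult_distrib)
      finally have "real (card (X P)) \<le> real n ^ D * (real (nat (6 * K)) ^ D * prime_weight p)"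
        unfolding q(2) using q(1) by (simp add: field_simps)
      then show ?thesis
        unfolding w'_def using prime_weight_nonneg[of p] by (auto intro: order.trans)
    next
      case 2
      have "(z' + 1) ^ 2 \<le> n ^ D"
        using D_pos n by (simp add: n_def self_le_power)
      also have "\<dots> < p ^ 2"
        using 2 min_index_bounds[OF mP(2)] by linarith
      finally have "p > z'"
        using power2_less_imp_less[of "z' + 1" p] by simp
      obtain c where "c \<in> X P" using False by blast
      then have "min_index p \<le> (k * n) ^ D"
        using index mP by blast
      then have "real (min_index p) \<le> real ((k * n) ^ D)"
        by (rule of_nat_mono)
      then have "1 \<le> real n ^ D * (real k ^ D * prime_weight p)"
        unfolding q(2) using q(1) by (simp add: field_simps power_mult_distrib)
      moreover have "real (card (X P)) \<le> 1"
        using 2 by simp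
      moreover have "real n ^ D * (real (nat (6 * K)) ^ D * prime_weight p) \<ge> 0"
        using prime_weight_nonneg[of p] by simp
      ultimately show ?thesis
        unfolding w'_def using \<open>p > z'\<close> by simp
    qed
  qed
  have fX: "finite (X P)" for P
    using finBox by (simp add: X_def)
  have "n ^ D = card Box"
    using fin by (simp add: Box_def card_PiE)
  also have "\<dots> \<le> card (\<Union>p\<in>Pr. \<Union>P\<in>Mx p. X P)"
    using finPr Mx fX by (intro card_mono cover) auto
  also have "\<dots> \<le> (\<Sum>p\<in>Pr. card (\<Union>P\<in>Mx p. X P))"
    by (intro card_UN_le finPr)
  also have "\<dots> \<le> (\<Sum>p\<in>Pr. \<Sum>P\<in>Mx p. card (X P))"
    using Mx by (intro sum_mono card_UN_le) auto
  finally have "real (n ^ D) \<le> real (\<Sum>p\<in>Pr. \<Sum>P\<in>Mx p. card (X P))"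
    by (rule of_nat_mono)
  also have "\<dots> \<le> (\<Sum>p\<in>Pr. real D * w' p)"
    unfolding of_nat_sum
  proof (intro sum_mono)
    fix p assume p: "p \<in> Pr"
    have w'0: "w' p \<ge> 0"
      using prime_weight_nonneg[of p] by (auto simp: w'_def)
    have "(\<Sum>P\<in>Mx p. real (card (X P))) \<le> real (card (Mx p)) * w' p"
      using cX[OF p] by (intro sum_bounded_above) auto
    also have "\<dots> \<le> real D * w' p"
      using Mx[OF p] w'0 by (intro mult_right_mono) auto
    finally show "(\<Sum>P\<in>Mx p. real (card (X P))) \<le> real D * w' p" .
  qed
  also have "\<dots> = (\<Sum>p\<in>Pr. (real n ^ D * a) * prime_weight p + (real n ^ D * a') * (if p > z' then prime_weight p else 0))"
    by (rule sum.cong) (simp_all add: w'_def a_def a'_def algebra_simps)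
  also have "\<dots> = (real n ^ D * a) * sum prime_weight Pr + (real n ^ D * a') * (\<Sum>p\<in>Pr. if p > z' then prime_weight p else 0)"
    by (simp only: sum.distrib sum_distrib_left)
  also have "\<dots> = real n ^ D * (a * sum prime_weight Pr + a' * (\<Sum>p\<in>Pr. if p > z' then prime_weight p else 0))"
    by (simp only: distrib_left mult.assoc)
  also have "(\<Sum>p\<in>Pr. if p > z' then prime_weight p else 0) = sum prime_weight {p \<in> Pr. p > z'}"
    using finPr by (simp add: sum.inter_filter)
  also have "real n ^ D * (a * sum prime_weight Pr + a' * sum prime_weight {p \<in> Pr. p > z'}) < real n ^ D * 1"
  proof (rule mult_strict_left_mono)
    have "sum prime_weight Pr < 1 / (3 * a)"
      using finPr by (intro z) (auto simp: Pr_def)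
    then have "a * sum prime_weight Pr < 1 / 3"
      using a by (simp add: field_simps)
    moreover have "sum prime_weight {p \<in> Pr. p > z'} < 1 / (3 * a')"
      using finPr by (intro z') auto
    then have "a' * sum prime_weight {p \<in> Pr. p > z'} < 1 / 3"
      using a' by (simp add: field_simps)
    ultimately show "a * sum prime_weight Pr + a' * sum prime_weight {p \<in> Pr. p > z'} < 1" by simp
  qed (use n in simp)
  finally show False by simp
qed

end

subsection \<open>The order generated by an algebraic integer\<close>

lemma poly_cong_int: "[x = y] (mod m) \<Longrightarrow> [poly h x = poly h y] (mod m)" for h :: "int poly"
  by (induction h) (auto intro!: cong_add cong_mult)

lemma monic_division:
  fixes F h :: "int poly"
  assumes "lead_coeff F = 1"
  shows "\<exists>q r. h = F * q + r \<and> (r = 0 \<or> degree r < degree F)"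
proof -
  obtain q r where qr: "pseudo_divmod h F = (q, r)"
    by fastforce
  have "F \<noteq> 0" using assms by auto
  from pseudo_divmod[OF this qr] assms show ?thesis
    by auto
qed

text \<open>\<open>F\<close> is the minimal polynomial of the algebraic integer
  \<open>\<alpha>\<close>, phrased without a field of fractions; it makes the first \<open>d\<close>
  powers of \<open>\<alpha>\<close> a basis of Z[\<open>\<alpha>\<close>].\<close>

locale monic_min_poly =
  fixes F :: "int poly" and \<alpha> :: "'a::{idom,ring_char_0}"
  assumes monic: "lead_coeff F = 1" and root: "ipoly F \<alpha> = 0"
    and minimal: "ipoly h \<alpha> = 0 \<Longrightarrow> degree h < degree F \<Longrightarrow> h = 0"
begin

abbreviation d where "d \<equiv> degree F"

lemma d_pos: "d > 0"
proof (rule ccontr)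
  assume "\<not> d > 0"
  then obtain c where "F = [:c:]"
    by (metis degree_eq_zeroE gr0I)
  then show False
    using monic root by auto
qed

lemma ipoly_eq_0_imp_dvd:
  assumes "ipoly h \<alpha> = 0"
  shows "F dvd h"
proof -
  obtain q r where h: "h = F * q + r" "r = 0 \<or> degree r < d"
    using monic_division[OF monic] by blast
  then have "ipoly r \<alpha> = 0"
    using assms root by (simp add: ipoly_add ipoly_mult)
  then have "r = 0"
    using h(2) minimal by blast
  with h show ?thesis by simp
qed

definition powers :: "'a set" where
  "powers = (\<lambda>i. \<alpha> ^ i) ` {..<d}"

lemma inj_on_powers: "inj_on (\<lambda>i. \<alpha> ^ i) {..<d}"
proof (rule inj_onI)
  fix i j assume ij: "i \<in> {..<d}" "j \<in> {..<d}" "\<alpha> ^ i = \<alpha> ^ j"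
  define h where "h = monom (1::int) i - monom 1 j"
  have "ipoly h \<alpha> = 0"
    using ij by (simp add: h_def ipoly_diff ipoly_monom)
  moreover have "degree h < d"
    unfolding h_def using ij by (intro degree_diff_less) (auto simp: degree_monom_eq)
  ultimately have "h = 0" by (rule minimal)
  then show "i = j"
    by (metis coeff_monom eq_iff_diff_eq_0 h_def one_neq_zero)
qed

lemma zcomb_powers: "zcomb powers c = (\<Sum>i<d. of_int (c (\<alpha> ^ i)) * \<alpha> ^ i)"
  unfolding powers_def zcomb_def by (subst sum.reindex[OF inj_on_powers]) simp

lemma zspan_powers: "zspan powers = range (\<lambda>h. ipoly h \<alpha>)"
proof (intro equalityI subsetI)
  fix x assume "x \<in> zspan powers"
  then obtain c where "x = zcomb powers c"
    by (rule zspanE)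
  then have "x = ipoly (\<Sum>i<d. monom (c (\<alpha> ^ i)) i) \<alpha>"
    by (simp add: zcomb_powers ipoly_sum ipoly_monom)
  then show "x \<in> range (\<lambda>h. ipoly h \<alpha>)" by blast
next
  fix x assume "x \<in> range (\<lambda>h. ipoly h \<alpha>)"
  then obtain h where h: "x = ipoly h \<alpha>" by blast
  obtain q r where qr: "h = F * q + r" "r = 0 \<or> degree r < d"
    using monic_division[OF monic] by blast
  then have x: "x = (\<Sum>i\<le>degree r. of_int (coeff r i) * \<alpha> ^ i)"
    using root by (simp add: h ipoly_add ipoly_mult flip: ipoly_altdef)
  have "degree r < d"
    using qr(2) d_pos by auto
  then show "x \<in> zspan powers"
    unfolding x by (intro zspan_sum zspan_scale zspan_base) (auto simp: powers_def)
qed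

sublocale z_order powers
proof
  show "finite powers" by (simp add: powers_def)
  show "1 \<in> powers"
    unfolding powers_def using d_pos by (intro image_eqI[of _ _ 0]) auto
next
  fix c b assume c: "zcomb powers c = 0" and b: "b \<in> powers"
  define h where "h = (\<Sum>i<d. monom (c (\<alpha> ^ i)) i)"
  have "ipoly h \<alpha> = 0"
    using c by (simp add: h_def zcomb_powers ipoly_sum ipoly_monom)
  moreover have "degree h < d"
    unfolding h_def using d_pos
    by (intro degree_sum_less) (auto intro: le_less_trans[OF degree_monom_le])
  ultimately have "h = 0" by (rule minimal)
  moreover obtain i where i: "i < d" "b = \<alpha> ^ i"
    using b by (auto simp: powers_def)
  then have "coeff h i = c b"
    by (simp add: h_def coeff_sum if_distrib sum.delta cong: if_cong)
  ultimately show "c b = 0" by simp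
next
  fix a b assume "a \<in> powers" "b \<in> powers"
  then obtain i j where "a * b = \<alpha> ^ (i + j)"
    by (auto simp: powers_def power_add)
  then have "a * b = ipoly (monom 1 (i + j)) \<alpha>"
    by (simp add: ipoly_monom)
  then show "a * b \<in> zspan powers"
    by (simp add: zspan_powers)
qed

text \<open>The kernel of the ring map from Z[\<open>\<alpha>\<close>] to Z/m that sends
  \<open>\<alpha>\<close> to \<open>x\<close>, which is well defined when \<open>m\<close> divides
  \<open>poly F x\<close>.\<close>

definition root_ideal :: "int \<Rightarrow> int \<Rightarrow> 'a set" where
  "root_ideal m x = {ipoly h \<alpha> | h. m dvd poly h x}"

text \<open>Polynomials with the same value at \<open>\<alpha>\<close> differ by a multiple of
  \<open>F\<close>, whose value at \<open>x\<close> vanishes modulo \<open>m\<close>. Hence the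
  integers in the ideal are the multiples of \<open>m\<close>.\<close>

lemma cyclic_root_ideal:
  assumes m: "m > 0" and x: "m dvd poly F x"
  shows "cyclic_ideal m (root_ideal m x)"
proof -
  have "is_ideal (root_ideal m x)"
    unfolding is_ideal_def
  proof (intro conjI ballI)
    show "root_ideal m x \<subseteq> R"
      by (auto simp: root_ideal_def zspan_powers)
    show "0 \<in> root_ideal m x"
      unfolding root_ideal_def by (intro CollectI exI[of _ 0]) auto
  next
    fix a b assume "a \<in> root_ideal m x" "b \<in> root_ideal m x"
    then obtain h k where "a = ipoly h \<alpha>" "b = ipoly k \<alpha>" "m dvd poly h x" "m dvd poly k x"
      by (auto simp: root_ideal_def)
    then show "a - b \<in> root_ideal m x"
      unfolding root_ideal_def by (intro CollectI exI[of _ "h - k"]) (auto simp: ipoly_diff)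
  next
    fix a b assume "a \<in> root_ideal m x" "b \<in> R"
    then obtain h k where "a = ipoly h \<alpha>" "b = ipoly k \<alpha>" "m dvd poly h x"
      by (auto simp: root_ideal_def zspan_powers)
    then show "a * b \<in> root_ideal m x"
      unfolding root_ideal_def by (intro CollectI exI[of _ "h * k"]) (auto simp: ipoly_mult)
  qed
  moreover have "of_int k \<in> root_ideal m x \<longleftrightarrow> m dvd k" for k
  proof
    assume "of_int k \<in> root_ideal m x"
    then obtain h where h: "of_int k = ipoly h \<alpha>" "m dvd poly h x"
      by (auto simp: root_ideal_def)
    then have "F dvd h - [:k:]"
      by (intro ipoly_eq_0_imp_dvd) (simp add: ipoly_diff)
    then obtain q where "h - [:k:] = F * q" by (elim dvdE)
    then have "poly h x - k = poly F x * poly q x"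
      by (metis poly_diff poly_mult poly_pCons poly_0 mult_zero_right add.right_neutral)
    with x have "m dvd poly h x - k"
      by simp
    with h show "m dvd k"
      by (metis dvd_diff_right_iff)
  next
    assume "m dvd k"
    then show "of_int k \<in> root_ideal m x"
      unfolding root_ideal_def by (intro CollectI exI[of _ "[:k:]"]) auto
  qed
  moreover have "\<exists>k. y - of_int k \<in> root_ideal m x" if y: "y \<in> R" for y
  proof -
    obtain h where "y = ipoly h \<alpha>"
      using y by (auto simp: zspan_powers)
    then have "y - of_int (poly h x) \<in> root_ideal m x"
      unfolding root_ideal_def by (intro CollectI exI[of _ "h - [:poly h x:]"]) (auto simp: ipoly_diff)
    then show ?thesis ..
  qed
  ultimately show ?thesis
    using m by (simp add: cyclic_ideal_def)
qed

text \<open>The integers in the ideal determine \<open>m\<close>; the ideal also contains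
  \<open>\<alpha> - x\<close> and \<open>\<alpha> - x'\<close>, hence their difference.\<close>

lemma root_ideal_eq_imp:
  assumes "m > 0" "m' > 0" "m dvd poly F x" "m' dvd poly F x'"
    and eq: "root_ideal m x = root_ideal m' x'"
  shows "m = m'" "[x = x'] (mod m)"
proof -
  have c: "cyclic_ideal m (root_ideal m x)" "cyclic_ideal m' (root_ideal m x)"
    using assms cyclic_root_ideal[of m x] cyclic_root_ideal[of m' x'] by auto
  have "m dvd k \<longleftrightarrow> m' dvd k" for k
    using cyclic_ideal_of_int[OF c(1)] cyclic_ideal_of_int[OF c(2)] by blast
  then show "m = m'"
    using assms(1,2) by (meson dvd_refl zdvd_antisym_nonneg less_imp_le)
  have 1: "\<alpha> - of_int x \<in> root_ideal m x"
    unfolding root_ideal_def by (intro CollectI exI[of _ "[:-x, 1:]"]) auto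
  have 2: "\<alpha> - of_int x' \<in> root_ideal m x"
    unfolding eq unfolding root_ideal_def by (intro CollectI exI[of _ "[:-x', 1:]"]) auto
  have "(\<alpha> - of_int x') - (\<alpha> - of_int x) \<in> root_ideal m x"
    by (rule ideal_diff[OF cyclic_ideal_is_ideal[OF c(1)] 2 1])
  then have "of_int (x - x') \<in> root_ideal m x"
    by simp
  then show "[x = x'] (mod m)"
    unfolding cyclic_ideal_of_int[OF c(1)] by (simp add: cong_iff_dvd_diff)
qed

section \<open>Primes modulo which the polynomial has two roots\<close>

definition two_roots :: "nat \<Rightarrow> bool" where
  "two_roots p \<longleftrightarrow> prime p \<and>
     (\<exists>x y. int p dvd poly F x \<and> int p dvd poly F y \<and> \<not> [x = y] (mod int p))"

text \<open>The interval contains \<open>p * t\<close> multiples of \<open>p\<close>, of which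
  \<open>t\<close> are multiples of \<open>p^2\<close>; as \<open>p \<ge> 2\<close>, at least half
  of them remain.\<close>

lemma card_exactly_divisible:
  fixes p t :: nat
  assumes "p \<ge> 2"
  shows "p * t \<le> 2 * card {m \<in> {p^2 * t<..2 * (p^2 * t)}. p dvd m \<and> \<not> p^2 dvd m}" (is "_ \<le> 2 * card ?A")
proof -
  define Z where "Z = {p * t<..2 * (p * t)} - (*) p ` {t<..2 * t}"
  have "(*) p ` Z \<subseteq> ?A"
  proof
    fix m assume "m \<in> (*) p ` Z"
    then obtain j where "m = p * j" "j \<in> Z"
      by (elim imageE)
    then have j: "m = p * j" "p * t < j" "j \<le> 2 * (p * t)" "j \<notin> (*) p ` {t<..2 * t}"
      by (simp_all add: Z_def)
    have "\<not> p^2 dvd m"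
    proof
      assume "p^2 dvd m"
      then obtain i where "j = p * i"
        using j assms by (auto simp: power2_eq_square)
      moreover from this have "t < i" "i \<le> 2 * t"
        using j assms by (simp_all add: mult.left_commute)
      ultimately show False
        using j(4) by auto
    qed
    moreover have "p * (p * t) < p * j" "p * j \<le> p * (2 * (p * t))"
      using j assms by auto
    ultimately show "m \<in> ?A"
      using j by (auto simp: power2_eq_square algebra_simps)
  qed
  then have "card ((*) p ` Z) \<le> card ?A"
    by (intro card_mono) auto
  moreover have "card ((*) p ` Z) = card Z"
    using assms by (intro card_image inj_onI) auto
  moreover have "card {p * t<..2 * (p * t)} - card ((*) p ` {t<..2 * t}) \<le> card Z"
    unfolding Z_def by (intro diff_card_le_card_Diff) auto
  moreover have "card ((*) p ` {t<..2 * t}) \<le> t"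
    using card_image_le[of "{t<..2 * t}" "(*) p"] by simp
  moreover have "2 * t \<le> p * t"
    using assms by simp
  moreover have "card {p * t<..2 * (p * t)} = p * t"
    by simp
  ultimately show ?thesis
    by linarith
qed

text \<open>For \<open>p\<close> in a finite set \<open>S\<close> and \<open>m\<close> exactly
  divisible by \<open>p\<close>, altering a fixed root modulo \<open>m\<close> at \<open>p\<close>
  alone gives another root. Different pairs give different root ideals, so
  \<open>ex_card_cyclic_ideals_le\<close> bounds their number and with it the sum of 1/p.\<close>

theorem summable_two_roots:
  assumes roots: "\<And>m. m > 0 \<Longrightarrow> \<exists>x. m dvd poly F x"
  shows "summable (\<lambda>p. if two_roots p then 1 / real p else 0)"
proof -
  obtain C where C: "\<And>M S. M \<ge> 1 \<Longrightarrow>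
      (\<forall>I\<in>S. \<exists>m. cyclic_ideal m I \<and> int M < 2 * m \<and> m \<le> int M) \<Longrightarrow> card S \<le> C * M"
    using ex_card_cyclic_ideals_le by blast
  obtain x0 where x0: "\<And>m. m > 0 \<Longrightarrow> m dvd poly F (x0 m)"
    using roots by metis
  have bound: "(\<Sum>p\<in>S. 1 / real p) \<le> 4 * real C" if S: "finite S" "\<And>p. p \<in> S \<Longrightarrow> two_roots p" for S
  proof -
    have prime: "prime p" if "p \<in> S" for p
      using S that by (auto simp: two_roots_def)
    \<comment> \<open>Divisibility by every \<open>p ^ 2\<close> lets
      \<open>card_exactly_divisible\<close> apply to all \<open>p\<close> in \<open>S\<close> on one
      interval.\<close>
    define Q where "Q = (\<Prod>p\<in>S. p ^ 2)"
    have Q: "Q > 0"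
      using prime S(1) prime_gt_0_nat unfolding Q_def by (intro prod_pos) auto
    define Z where "Z = (\<lambda>p. {m \<in> {Q<..2 * Q}. p dvd m \<and> \<not> p^2 dvd m})"
    have "\<exists>y. int m dvd poly F y \<and> [y = x0 (int m)] (mod int (m div p)) \<and> \<not> [y = x0 (int m)] (mod int p)"
      if pm: "p \<in> S" "m \<in> Z p" for p m
    proof -
      have m: "m > 0" "m = p * (m div p)"
        using pm by (auto simp: Z_def)
      have "\<not> p dvd m div p"
        using pm m(2) by (auto simp: Z_def power2_eq_square)
      then have cop: "coprime (int (m div p)) (int p)"
        using prime[OF pm(1)] by (metis coprime_commute coprime_int_iff prime_imp_coprime)
      \<comment> \<open>Of two incongruent roots modulo \<open>p\<close>, at least one differs from
        the chosen root.\<close>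
      obtain w where w: "int p dvd poly F w" "\<not> [w = x0 (int m)] (mod int p)"
        using S(2)[OF pm(1)] unfolding two_roots_def by (metis cong_sym cong_trans)
      obtain y where y: "[y = x0 (int m)] (mod int (m div p))" "[y = w] (mod int p)"
        using binary_chinese_remainder_int[OF cop] by blast
      have mi: "int m = int (m div p) * int p"
        using m(2) by (metis mult.commute of_nat_mult)
      have "int (m div p) dvd poly F (x0 (int m))"
        using x0[of "int m"] m mi by (metis dvd_mult_left of_nat_0_less_iff)
      then have "int (m div p) dvd poly F y"
        using poly_cong_int[OF y(1)] cong_dvd_iff by blast
      moreover have "int p dvd poly F y"
        using poly_cong_int[OF y(2)] w(1) cong_dvd_iff by blast
      ultimately have "int m dvd poly F y"
        unfolding mi using cop by (simp add: divides_mult)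
      moreover have "\<not> [y = x0 (int m)] (mod int p)"
        using y(2) w(2) by (metis cong_sym cong_trans)
      ultimately show ?thesis
        using y by blast
    qed
    then obtain y where y: "\<And>p m. p \<in> S \<Longrightarrow> m \<in> Z p \<Longrightarrow> int m dvd poly F (y p m)"
        "\<And>p m. p \<in> S \<Longrightarrow> m \<in> Z p \<Longrightarrow> [y p m = x0 (int m)] (mod int (m div p))"
        "\<And>p m. p \<in> S \<Longrightarrow> m \<in> Z p \<Longrightarrow> \<not> [y p m = x0 (int m)] (mod int p)"
      by metis
    define \<Phi> where "\<Phi> = (\<lambda>(p, m). root_ideal (int m) (y p m))"
    have "inj_on \<Phi> (Sigma S Z)"
    proof (rule inj_onI)
      fix u v assume uv: "u \<in> Sigma S Z" "v \<in> Sigma S Z" "\<Phi> u = \<Phi> v"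
      obtain p m p' m' where e: "u = (p, m)" "v = (p', m')"
        by fastforce
      have pm: "p \<in> S" "m \<in> Z p" "p' \<in> S" "m' \<in> Z p'"
        using uv by (auto simp: e)
      have eq: "root_ideal (int m) (y p m) = root_ideal (int m') (y p' m')"
        using uv by (simp add: \<Phi>_def e)
      have "int m > 0" "int m' > 0"
        using pm by (auto simp: Z_def)
      note * = root_ideal_eq_imp[OF this y(1)[OF pm(1,2)] y(1)[OF pm(3,4)] eq]
      have m: "m = m'" using *(1) by simp
      \<comment> \<open>\<open>p\<close> is recovered as the prime where the root departs from
        \<open>x0 m\<close>: the root built for another prime \<open>p'\<close> still agrees with
        \<open>x0 m\<close> modulo \<open>m div p'\<close>, a multiple of \<open>p\<close>.\<close>
      have "p = p'"
      proof (rule ccontr)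
        assume "p \<noteq> p'"
        have "p dvd p' * (m div p')"
          using pm by (auto simp: Z_def m)
        moreover have "coprime p p'"
          using \<open>p \<noteq> p'\<close> prime pm primes_coprime by blast
        ultimately have "int p dvd int (m div p')"
          by (simp add: coprime_dvd_mult_right_iff)
        then have "[y p' m' = x0 (int m')] (mod int p)"
          using y(2)[OF pm(3,4)] m by (metis cong_dvd_modulus)
        moreover have "int p dvd int m"
          using pm by (auto simp: Z_def)
        then have "[y p m = y p' m'] (mod int p)"
          using *(2) cong_dvd_modulus by blast
        ultimately show False
          using y(3)[OF pm(1,2)] m cong_trans by blast
      qed
      with m show "u = v" by (simp add: e)
    qed
    then have "card (Sigma S Z) = card (\<Phi> ` Sigma S Z)"
      by (simp add: card_image)
    also have "\<dots> \<le> C * (2 * Q)"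
    proof (rule C)
      show "1 \<le> 2 * Q" using Q by simp
      show "\<forall>I\<in>\<Phi> ` Sigma S Z. \<exists>m. cyclic_ideal m I \<and> int (2 * Q) < 2 * m \<and> m \<le> int (2 * Q)"
      proof
        fix I assume "I \<in> \<Phi> ` Sigma S Z"
        then obtain p m where pm: "p \<in> S" "m \<in> Z p" "I = root_ideal (int m) (y p m)"
          by (auto simp: \<Phi>_def)
        then have "cyclic_ideal (int m) I"
          using cyclic_root_ideal[of "int m" "y p m"] y(1)[OF pm(1,2)] by (auto simp: Z_def)
        then show "\<exists>m. cyclic_ideal m I \<and> int (2 * Q) < 2 * m \<and> m \<le> int (2 * Q)"
          using pm by (intro exI[of _ "int m"]) (auto simp: Z_def)
      qed
    qed
    also have "card (Sigma S Z) = (\<Sum>p\<in>S. card (Z p))"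
      using S(1) by (subst card_SigmaI) (auto simp: Z_def)
    finally have count: "(\<Sum>p\<in>S. card (Z p)) \<le> C * (2 * Q)" .
    have "real Q / (2 * real p) \<le> real (card (Z p))" if "p \<in> S" for p
    proof -
      have "p ^ 2 dvd Q"
        unfolding Q_def using S(1) that by (intro dvd_prodI)
      then obtain t where t: "Q = p ^ 2 * t" by (elim dvdE)
      have "p * t \<le> 2 * card (Z p)"
        unfolding Z_def t using prime[OF that] by (intro card_exactly_divisible prime_ge_2_nat)
      then have "real (p * t) \<le> real (2 * card (Z p))"
        by (rule of_nat_mono)
      moreover have "real Q / (2 * real p) = real (p * t) / 2"
        using prime[OF that] prime_gt_0_nat[of p] by (simp add: t power2_eq_square)
      ultimately show ?thesis by simp
    qed
    then have "(\<Sum>p\<in>S. real Q / (2 * real p)) \<le> (\<Sum>p\<in>S. real (card (Z p)))"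
      by (intro sum_mono)
    also have "\<dots> = real (\<Sum>p\<in>S. card (Z p))"
      by simp
    also have "\<dots> \<le> real (C * (2 * Q))"
      using count by (rule of_nat_mono)
    finally have "(\<Sum>p\<in>S. real Q / (2 * real p)) \<le> real (C * (2 * Q))" .
    moreover have "(\<Sum>p\<in>S. real Q / (2 * real p)) = real Q / 2 * (\<Sum>p\<in>S. 1 / real p)"
      by (simp add: sum_distrib_left)
    ultimately have "real Q * (\<Sum>p\<in>S. 1 / real p) \<le> real Q * (4 * real C)"
      by (simp add: algebra_simps)
    then show ?thesis
      using Q by simp
  qed
  show ?thesis
  proof (rule summableI_nonneg_bounded)
    fix n
    have "(\<Sum>p<n. if two_roots p then 1 / real p else 0) = (\<Sum>p\<in>{p\<in>{..<n}. two_roots p}. 1 / real p)"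
      by (rule sum.inter_filter[symmetric]) simp
    also have "\<dots> \<le> 4 * real C"
      by (rule bound) auto
    finally show "(\<Sum>p<n. if two_roots p then 1 / real p else 0) \<le> 4 * real C" .
  qed simp
qed

end

subsection \<open>An order containing multiples of two roots\<close>

text \<open>A maximal independent set \<open>B\<close> of generators containing 1 spans
  \<open>M\<close> up to a common denominator \<open>N\<close>. Its span need not be closed under
  products; scaling every basis element except 1 by \<open>N\<close> repairs this.\<close>

lemma ex_z_order_commensurable:
  fixes M :: "'a::{idom,ring_char_0} set"
  assumes M: "finite M" "1 \<in> M" "\<And>x y. x \<in> M \<Longrightarrow> y \<in> M \<Longrightarrow> x * y \<in> zspan M"
  shows "\<exists>B N. z_order B \<and> N > 0 \<and> (\<forall>x\<in>zspan M. of_int N * x \<in> zspan B)"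
proof -
  define ind where "ind = (\<lambda>B. \<forall>c::'a \<Rightarrow> int. zcomb B c = 0 \<longrightarrow> (\<forall>b\<in>B. c b = 0))"
  define \<A> where "\<A> = {B. B \<subseteq> M \<and> 1 \<in> B \<and> ind B}"
  have "finite \<A>"
    using M(1) by (auto simp: \<A>_def)
  moreover have "{1} \<in> \<A>"
    using M(2) by (auto simp: \<A>_def ind_def zcomb_def)
  ultimately obtain B where B: "B \<in> \<A>" "\<And>A. A \<in> \<A> \<Longrightarrow> B \<subseteq> A \<Longrightarrow> A = B"
    using finite_has_maximal[of \<A>] by (metis empty_iff)
  have B': "B \<subseteq> M" "1 \<in> B" "ind B" "finite B"
    using B(1) M(1) finite_subset by (auto simp: \<A>_def)
  have "\<exists>N>0. of_int N * \<mu> \<in> zspan B" if \<mu>: "\<mu> \<in> M" for \<mu>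
  proof (cases "\<mu> \<in> B")
    case True
    then show ?thesis
      using zspan_base[OF B'(4)] by (intro exI[of _ 1]) auto
  next
    case False
    then have "insert \<mu> B \<notin> \<A>"
      using B(2)[of "insert \<mu> B"] by auto
    then have "\<not> ind (insert \<mu> B)"
      using B' \<mu> by (auto simp: \<A>_def)
    then obtain c b where c: "zcomb (insert \<mu> B) c = 0" "b \<in> insert \<mu> B" "c b \<noteq> 0"
      by (auto simp: ind_def)
    have eq: "of_int (c \<mu>) * \<mu> = - zcomb B c"
      using c(1) False B'(4) by (simp add: zcomb_def eq_neg_iff_add_eq_0)
    have "c \<mu> \<noteq> 0"
    proof
      assume 0: "c \<mu> = 0"
      then have "zcomb B c = 0" using eq by simp
      then show False using B'(3) c 0 by (auto simp: ind_def)
    qed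
    moreover have "of_int \<bar>c \<mu>\<bar> * \<mu> = of_int (sgn (c \<mu>)) * (of_int (c \<mu>) * \<mu>)"
      by (simp add: abs_sgn mult_ac)
    then have "of_int \<bar>c \<mu>\<bar> * \<mu> = of_int (- sgn (c \<mu>)) * zcomb B c"
      unfolding eq by simp
    then have "of_int \<bar>c \<mu>\<bar> * \<mu> \<in> zspan B"
      by (metis zcomb_in_zspan zspan_scale)
    ultimately show ?thesis
      by (intro exI[of _ "\<bar>c \<mu>\<bar>"]) simp
  qed
  then obtain n where n: "\<And>\<mu>. \<mu> \<in> M \<Longrightarrow> n \<mu> > 0" "\<And>\<mu>. \<mu> \<in> M \<Longrightarrow> of_int (n \<mu>) * \<mu> \<in> zspan B"
    by metis
  define N where "N = (\<Prod>\<mu>\<in>M. n \<mu>)"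
  have N: "N > 0"
    using n by (auto simp: N_def intro: prod_pos)
  have NM: "of_int N * \<mu> \<in> zspan B" if "\<mu> \<in> M" for \<mu>
  proof -
    have "N = (\<Prod>\<nu>\<in>M - {\<mu>}. n \<nu>) * n \<mu>"
      unfolding N_def using M(1) that by (simp add: prod.remove mult.commute)
    then have "of_int N * \<mu> = of_int (\<Prod>\<nu>\<in>M - {\<mu>}. n \<nu>) * (of_int (n \<mu>) * \<mu>)"
      by (simp add: mult.assoc)
    also have "\<dots> \<in> zspan B"
      by (intro zspan_scale n that)
    finally show ?thesis .
  qed
  have Nspan: "of_int N * x \<in> zspan B" if x: "x \<in> zspan M" for x
  proof -
    obtain c where "x = zcomb M c"
      using x by (rule zspanE)
    then have "of_int N * x = (\<Sum>\<mu>\<in>M. of_int (c \<mu>) * (of_int N * \<mu>))"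
      by (simp add: zcomb_def sum_distrib_left mult_ac)
    also have "\<dots> \<in> zspan B"
      by (intro zspan_sum zspan_scale NM)
    finally show ?thesis .
  qed
  \<comment> \<open>A product of two scaled elements carries \<open>N * N\<close>: one factor brings
    \<open>a * b\<close> into the span of \<open>B\<close>, the other into the span of the scaled
    basis. Leaving 1 unscaled keeps it in the basis.\<close>
  define w where "w = (\<lambda>b::'a. if b = 1 then 1 else N)"
  define s where "s = (\<lambda>b. of_int (w b) * b)"
  have w0: "w b > 0" for b
    using N by (simp add: w_def)
  \<comment> \<open>Scaling could only merge 1 with some \<open>N * b\<close>, and independence
    excludes that.\<close>
  have inj: "inj_on s B"
  proof (rule inj_onI, rule ccontr)
    fix a b assume ab: "a \<in> B" "b \<in> B" "s a = s b" "a \<noteq> b"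
    define c where "c = (\<lambda>x. (if x = a then w a else 0) - (if x = b then w b else 0))"
    have "zcomb B c = 0"
      unfolding c_def zcomb_diff[symmetric] using ab B'(4) by (simp add: zcomb_single s_def)
    then have "c a = 0"
      using B'(3) ab(1) by (auto simp: ind_def)
    then show False
      using ab(4) w0[of a] by (simp add: c_def)
  qed
  have s1: "s 1 = 1" by (simp add: s_def w_def)
  have zs: "zcomb (s ` B) c = zcomb B (\<lambda>b. c (s b) * w b)" for c
    unfolding zcomb_def by (subst sum.reindex[OF inj]) (simp add: s_def mult_ac)
  have span_s: "of_int N * x \<in> zspan (s ` B)" if x: "x \<in> zspan B" for x
  proof -
    obtain c where "x = zcomb B c"
      using x by (rule zspanE)
    then have "of_int N * x = (\<Sum>b\<in>B. of_int N * (of_int (c b) * b))"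
      by (simp add: zcomb_def sum_distrib_left)
    also have "\<dots> = (\<Sum>b\<in>B. of_int (c b * (N div w b)) * s b)"
      using N by (intro sum.cong) (auto simp: s_def w_def)
    also have "\<dots> \<in> zspan (s ` B)"
      using B'(4) by (intro zspan_sum zspan_scale zspan_base) auto
    finally show ?thesis .
  qed
  have "z_order (s ` B)"
  proof
    show "finite (s ` B)" using B' by simp
    show "1 \<in> s ` B" using B'(2) s1 by (metis image_eqI)
  next
    fix c b assume c: "zcomb (s ` B) c = 0" and "b \<in> s ` B"
    then obtain a where a: "a \<in> B" "b = s a" by blast
    have "c (s a) * w a = 0"
      using c a(1) B'(3) unfolding zs ind_def by blast
    then show "c b = 0"
      using w0[of a] a by simp
  next
    fix x y assume xy: "x \<in> s ` B" "y \<in> s ` B"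
    then obtain a b where ab: "a \<in> B" "b \<in> B" "x = s a" "y = s b" by blast
    have "of_int N * (of_int N * (a * b)) \<in> zspan (s ` B)"
      using M(3)[of a b] ab B'(1) by (intro span_s Nspan) blast
    moreover have base: "z \<in> zspan (s ` B)" if "z \<in> s ` B" for z
      using B' that by (intro zspan_base) auto
    ultimately show "x * y \<in> zspan (s ` B)"
      using xy base[OF xy(1)] base[OF xy(2)] by (cases "a = 1"; cases "b = 1") (auto simp: ab s1 s_def w_def mult_ac)
  qed
  moreover have "of_int (N * N) * x \<in> zspan (s ` B)" if "x \<in> zspan M" for x
    using span_s[OF Nspan[OF that]] by (simp add: mult.assoc)
  moreover have "N * N > 0"
    using N by simp
  ultimately show ?thesis by blast
qed

text \<open>The products \<open>\<alpha> ^ i * \<beta> ^ j\<close> span the ring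
  Z[\<open>\<alpha>\<close>, \<open>\<beta>\<close>] but may be dependent, so a commensurable order
  takes its place and holds only multiples of the roots.\<close>

lemma ex_z_order_two_roots:
  fixes \<alpha> \<beta> :: "'a::{idom,ring_char_0}"
  assumes F: "lead_coeff F = 1" "degree F > 0" and roots: "ipoly F \<alpha> = 0" "ipoly F \<beta> = 0"
  shows "\<exists>B N. z_order B \<and> N > 0 \<and> of_int N * \<alpha> \<in> zspan B \<and> of_int N * \<beta> \<in> zspan B"
proof -
  define n where "n = degree F"
  define M where "M = (\<lambda>(i, j). \<alpha> ^ i * \<beta> ^ j) ` ({..<n} \<times> {..<n})"
  have red: "\<exists>r. ipoly h x = ipoly r x \<and> degree r < n" if "ipoly F x = 0" for h and x :: 'a
  proof -
    obtain q r where "h = F * q + r" "r = 0 \<or> degree r < degree F"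
      using monic_division[OF F(1)] by blast
    then show ?thesis
      using that F(2) by (intro exI[of _ r]) (auto simp: ipoly_add ipoly_mult n_def)
  qed
  have fin: "finite M" by (simp add: M_def)
  have span: "ipoly h \<alpha> * ipoly k \<beta> \<in> zspan M" for h k
  proof -
    obtain r s where rs: "ipoly h \<alpha> = ipoly r \<alpha>" "degree r < n" "ipoly k \<beta> = ipoly s \<beta>" "degree s < n"
      using red roots by metis
    have "ipoly h \<alpha> * ipoly k \<beta> =
        (\<Sum>i\<le>degree r. \<Sum>j\<le>degree s. of_int (coeff r i * coeff s j) * (\<alpha> ^ i * \<beta> ^ j))"
      unfolding rs(1,3) unfolding ipoly_altdef sum_product by (simp add: mult_ac)
    also have "\<dots> \<in> zspan M"
    proof (intro zspan_sum zspan_scale zspan_base[OF fin])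
      fix i j assume "i \<in> {..degree r}" "j \<in> {..degree s}"
      then show "\<alpha> ^ i * \<beta> ^ j \<in> M"
        unfolding M_def using rs by (intro image_eqI[of _ _ "(i, j)"]) auto
    qed
    finally show ?thesis .
  qed
  have "x * y \<in> zspan M" if xy: "x \<in> M" "y \<in> M" for x y
  proof -
    obtain i j k l where "x = \<alpha> ^ i * \<beta> ^ j" "y = \<alpha> ^ k * \<beta> ^ l"
      using xy by (auto simp: M_def)
    then have "x * y = ipoly (monom 1 (i + k)) \<alpha> * ipoly (monom 1 (j + l)) \<beta>"
      by (simp add: ipoly_monom power_add mult_ac)
    then show ?thesis using span by simp
  qed
  moreover have "1 \<in> M"
    unfolding M_def using F(2) by (intro image_eqI[of _ _ "(0, 0)"]) (auto simp: n_def)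
  ultimately obtain B N where BN: "z_order B" "N > 0" "\<forall>x\<in>zspan M. of_int N * x \<in> zspan B"
    using ex_z_order_commensurable[OF fin] by blast
  have "\<alpha> \<in> zspan M" "\<beta> \<in> zspan M"
    using span[of "[:0, 1:]" 1] span[of 1 "[:0, 1:]"] by (simp_all add: one_pCons)
  with BN show ?thesis by blast
qed

lemma ipoly_int: "ipoly h x = poly h x"
  using ipoly_of_int[of h x, where 'a = int] by simp

text \<open>The polynomial N^d h(X/N) with d the degree of \<open>h\<close>; it vanishes at
  \<open>N * x\<close> whenever \<open>h\<close> vanishes at \<open>x\<close>.\<close>

definition homogenize :: "int \<Rightarrow> int poly \<Rightarrow> int poly" where
  "homogenize N h = (\<Sum>i\<le>degree h. monom (coeff h i * N ^ (degree h - i)) i)"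

lemma ipoly_homogenize: "ipoly (homogenize N h) (of_int N * x) = of_int N ^ degree h * ipoly h x"
proof -
  have "ipoly (homogenize N h) (of_int N * x)
      = (\<Sum>i\<le>degree h. of_int (coeff h i * N ^ (degree h - i)) * (of_int N * x) ^ i)"
    by (simp add: homogenize_def ipoly_sum ipoly_monom)
  also have "\<dots> = (\<Sum>i\<le>degree h. of_int N ^ degree h * (of_int (coeff h i) * x ^ i))"
  proof (rule sum.cong[OF refl])
    fix i assume "i \<in> {..degree h}"
    then have "of_int N ^ degree h = (of_int N ^ (degree h - i) * of_int N ^ i :: 'a)"
      by (simp flip: power_add)
    then show "of_int (coeff h i * N ^ (degree h - i)) * (of_int N * x) ^ i
        = of_int N ^ degree h * (of_int (coeff h i) * x ^ i)"
      by (simp add: power_mult_distrib mult_ac)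
  qed
  finally show ?thesis
    by (simp add: ipoly_altdef sum_distrib_left)
qed

context z_order
begin

lemma ideal_ipoly_diff:
  assumes I: "is_ideal I" and x: "x \<in> R" "y \<in> R" "x - y \<in> I"
  shows "ipoly h x - ipoly h y \<in> I"
proof (induction h)
  case 0
  then show ?case using ideal_0[OF I] by simp
next
  case (pCons c h)
  have "x * (ipoly h x - ipoly h y) + (x - y) * ipoly h y \<in> I"
    using pCons x by (intro ideal_add[OF I] ideal_mult'[OF I] ideal_mult[OF I] ipoly_R) auto
  then show ?case
    by (simp add: algebra_simps)
qed

text \<open>\<open>k\<close> is a root modulo \<open>p\<close> of the homogenized polynomial because
  \<open>N * \<alpha>\<close> is a root of it in \<open>R\<close>. Dividing by \<open>N\<close>
  modulo \<open>p\<close> turns \<open>k\<close> into a root of \<open>F\<close>.\<close>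

lemma root_mod_degree_one_prime:
  assumes P: "is_ideal P" "1 \<notin> P" "prime p" "of_nat p \<in> P" and N: "\<not> int p dvd N"
    and u: "of_int N * \<alpha> \<in> R" "ipoly F \<alpha> = 0" and k: "of_int N * \<alpha> - of_int k \<in> P"
  shows "\<exists>x. int p dvd poly F x \<and> [N * x = k] (mod int p)"
proof -
  define H where "H = homogenize N F"
  have "ipoly H (of_int N * \<alpha>) = 0"
    by (simp add: H_def ipoly_homogenize u)
  then have "- ipoly H (of_int k) \<in> P"
    using ideal_ipoly_diff[OF P(1) u(1) of_int_R k, of H] by simp
  then have "of_int (poly H k) \<in> P"
    using ideal_uminus[OF P(1)] by (metis ipoly_of_int minus_minus)
  then have pH: "int p dvd poly H k"
    by (rule of_int_ideal_imp_dvd[OF P])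
  have "coprime N (int p)"
    using P(3) N by (metis coprime_commute prime_imp_coprime prime_int_nat_transfer of_nat_0_le_iff nat_int prime_nat_int_transfer)
  then obtain x where x: "[N * x = k] (mod int p)"
    by (metis cong_solve_coprime_int cong_scalar_right mult.assoc mult_1)
  have "int p dvd poly H (N * x)"
    using poly_cong_int[OF x, of H] pH cong_dvd_iff by blast
  also have "poly H (N * x) = N ^ degree F * poly F x"
    unfolding H_def using ipoly_homogenize[of N F x] by (simp add: ipoly_int)
  finally have "int p dvd poly F x"
    using P(3) N by (metis prime_dvd_mult_iff prime_dvd_power prime_nat_int_transfer)
  with x show ?thesis by blast
qed

end

lemma (in monic_min_poly) ex_modulus_without_root:
  assumes \<beta>: "ipoly F \<beta> = 0" "\<beta> \<noteq> \<alpha>"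
  shows "\<exists>m>0. \<forall>x. \<not> m dvd poly F x"
proof (rule ccontr)
  assume "\<not> ?thesis"
  then have summable: "summable (\<lambda>p. if two_roots p then 1 / real p else 0)"
    by (intro summable_two_roots) auto
  obtain B N where B: "z_order B" "N > 0" "of_int N * \<alpha> \<in> zspan B" "of_int N * \<beta> \<in> zspan B"
    using ex_z_order_two_roots[OF monic d_pos root \<beta>(1)] by blast
  interpret O: z_order B by fact
  have "of_int N * \<alpha> - of_int N * \<beta> \<in> zspan B"
    using B by (intro zspan_diff)
  moreover have "of_int N * \<alpha> - of_int N * \<beta> \<noteq> 0"
    using B(2) \<beta>(2) by simp
  \<comment> \<open>If the two roots found below agreed modulo \<open>p\<close>, then
    \<open>P\<close> would contain \<open>N * \<alpha> - N * \<beta>\<close> and so its multiple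
    \<open>L\<close>; primes beyond \<open>N * L\<close> rule this out.\<close>
  ultimately obtain t L where L: "t \<in> zspan B" "L > 0" "(of_int N * \<alpha> - of_int N * \<beta>) * t = of_int L"
    using O.ex_inverse by blast
  have two: "two_roots p" if O: "O.degree_one_prime p" and large: "p > nat (N * L)" for p
  proof -
    obtain P where p: "prime p" and P: "O.is_ideal P" "of_nat p \<in> P" "1 \<notin> P" "\<forall>x\<in>zspan B. \<exists>k. x - of_int k \<in> P"
      using O by (auto simp: O.degree_one_prime_def)
    have "\<not> int p dvd N * L"
      using large B(2) L(2) zdvd_not_zless[of "N * L" "int p"] by auto
    then have pN: "\<not> int p dvd N" and pL: "\<not> int p dvd L"
      by auto
    obtain k1 k2 where k: "of_int N * \<alpha> - of_int k1 \<in> P" "of_int N * \<beta> - of_int k2 \<in> P"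
      using P(4) B by blast
    obtain x where x: "int p dvd poly F x" "[N * x = k1] (mod int p)"
      using O.root_mod_degree_one_prime[OF P(1,3) p P(2) pN B(3) root k(1)] by blast
    obtain y where y: "int p dvd poly F y" "[N * y = k2] (mod int p)"
      using O.root_mod_degree_one_prime[OF P(1,3) p P(2) pN B(4) \<beta>(1) k(2)] by blast
    have "\<not> [x = y] (mod int p)"
    proof
      assume "[x = y] (mod int p)"
      then have "[N * x = N * y] (mod int p)"
        by (rule cong_scalar_left)
      then have "[k1 = k2] (mod int p)"
        using x(2) y(2) by (meson cong_sym cong_trans)
      then obtain e where e: "k1 - k2 = int p * e"
        by (auto simp: cong_iff_dvd_diff)
      have "(of_int N * \<alpha> - of_int k1) - (of_int N * \<beta> - of_int k2) + of_nat p * of_int e \<in> P"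
        by (rule O.ideal_add[OF P(1) O.ideal_diff[OF P(1) k] O.ideal_mult[OF P(1,2) O.of_int_R]])
      also have "(of_int N * \<alpha> - of_int k1) - (of_int N * \<beta> - of_int k2) + of_nat p * of_int e
          = of_int N * \<alpha> - of_int N * \<beta> - of_int (k1 - k2) + of_int (int p * e)"
        by simp
      also have "\<dots> = of_int N * \<alpha> - of_int N * \<beta>"
        unfolding e by simp
      finally have "of_int L \<in> P"
        using O.ideal_mult[OF P(1) _ L(1)] L(3) by metis
      then show False
        using O.of_int_ideal_imp_dvd[OF P(1,3) p P(2)] pL by blast
    qed
    with p x y show ?thesis
      unfolding two_roots_def by blast
  qed
  have "summable (\<lambda>p. if O.degree_one_prime p then 1 / real p else 0)"
    by (rule summable_comparison_test'[OF summable, of "Suc (nat (N * L))"]) (use two in auto)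
  then show False
    using O.not_summable_degree_one_primes by contradiction
qed

subsection \<open>Irreducible polynomials without roots modulo some integer\<close>

text \<open>Pseudo-division of \<open>f\<close> by a polynomial \<open>g\<close> of least degree
  vanishing at \<open>\<alpha>\<close> leaves no remainder: \<open>a * f = g * q\<close>. As
  \<open>f\<close> is prime, it divides \<open>g\<close>, contradicting the degree of
  \<open>h\<close>, or \<open>q\<close>, which makes \<open>g\<close> constant.\<close>

lemma irreducible_minimal:
  fixes \<alpha> :: "'a::{idom,ring_char_0}"
  assumes f: "irreducible f" "ipoly f \<alpha> = 0" and h: "ipoly h \<alpha> = 0" "degree h < degree f"
  shows "h = 0"
proof (rule ccontr)
  assume "h \<noteq> 0"
  define P where "P = (\<lambda>g. g \<noteq> 0 \<and> ipoly g \<alpha> = 0)"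
  define g where "g = arg_min degree P"
  have "P h" using h \<open>h \<noteq> 0\<close> by (simp add: P_def)
  then have g: "P g" and least: "\<And>k. P k \<Longrightarrow> degree g \<le> degree k"
    unfolding g_def by (auto intro: arg_min_natI arg_min_nat_le)
  have g0: "g \<noteq> 0" using g by (simp add: P_def)
  obtain a q r where qr: "a \<noteq> 0" "smult a f = g * q + r" "r = 0 \<or> degree r < degree g"
    using pseudo_mod[OF g0, of f] by blast
  have "ipoly r \<alpha> = ipoly (smult a f) \<alpha> - ipoly (g * q) \<alpha>"
    unfolding qr(2) by (simp add: ipoly_add)
  also have "\<dots> = 0"
    using f(2) g by (simp add: ipoly_smult ipoly_mult P_def)
  finally have "r = 0"
    using least[of r] qr(3) unfolding P_def by (meson leD)
  then have eq: "smult a f = g * q"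
    using qr by simp
  then have "f dvd g * q"
    by (metis dvd_smult dvd_refl)
  then consider "f dvd g" | "f dvd q"
    using f(1) irreducible_imp_prime_elem prime_elem_dvd_mult_iff by blast
  then show False
  proof cases
    case 1
    then have "degree f \<le> degree g"
      using g0 by (rule dvd_imp_degree_le)
    with least[OF \<open>P h\<close>] h(2) show False by simp
  next
    case 2
    have "q \<noteq> 0"
      using eq qr(1) f(1) by auto
    have "degree f = degree g + degree q"
      using arg_cong[OF eq, of degree] qr(1) g0 \<open>q \<noteq> 0\<close> by (simp add: degree_mult_eq)
    moreover have "degree f \<le> degree q"
      using 2 \<open>q \<noteq> 0\<close> by (rule dvd_imp_degree_le)
    ultimately have "degree g = 0" by simp
    then obtain c where "g = [:c:]" by (rule degree_eq_zeroE)
    with g show False by (auto simp: P_def)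
  qed
qed

lemma ipoly_pcompose: "ipoly (pcompose h g) x = ipoly h (ipoly g x)"
  by (induction h) (auto simp: pcompose_pCons ipoly_add ipoly_mult)

lemma ipoly_pderiv: "ipoly (pderiv h) x = poly (pderiv (map_poly of_int h)) x" for x :: "'a::{idom,ring_char_0}"
  unfolding ipoly_def
  by (rule arg_cong[of _ _ "\<lambda>p. poly p x"]) (auto intro!: poly_eqI simp: coeff_map_poly coeff_pderiv)

text \<open>Separability provides two distinct complex roots. Scaling them by the leading
  coefficient makes them algebraic integers, to which \<open>ex_modulus_without_root\<close>
  applies.\<close>

theorem irreducible_ex_modulus_without_root:
  fixes f :: "int poly"
  assumes f: "irreducible f" and deg: "degree f \<ge> 2"
  shows "\<exists>m>0. \<forall>x. \<not> m dvd poly f x"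
proof -
  define d where "d = degree f"
  define a where "a = lead_coeff f"
  have f0: "f \<noteq> 0" and a: "a \<noteq> 0"
    using deg by (auto simp: a_def)
  define fc where "fc = (map_poly of_int f :: complex poly)"
  have fc: "ipoly f z = poly fc z" for z
    by (simp add: ipoly_def fc_def)
  have dfc: "degree fc = d"
    by (simp add: fc_def d_def degree_map_poly)
  have "\<not> constant (poly fc)"
    using dfc deg constant_degree[of fc] by (simp add: d_def)
  then obtain \<alpha> where \<alpha>: "poly fc \<alpha> = 0"
    using fundamental_theorem_of_algebra by blast
  then have \<alpha>': "ipoly f \<alpha> = 0" by (simp add: fc)
  obtain g where g: "fc = [:-\<alpha>, 1:] * g"
    using \<alpha> by (metis dvdE poly_eq_0_iff_dvd)
  have "g \<noteq> 0" using g dfc deg by (auto simp: d_def)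
  then have "degree g = d - 1"
    using dfc unfolding g by (subst (asm) degree_mult_eq) auto
  then have "\<not> constant (poly g)"
    using deg constant_degree[of g] by (simp add: d_def)
  then obtain \<beta> where "poly g \<beta> = 0"
    using fundamental_theorem_of_algebra by blast
  then have \<beta>: "ipoly f \<beta> = 0"
    by (simp add: fc g)
  \<comment> \<open>The derivative has smaller degree, so by minimality it cannot vanish at
    \<open>\<alpha>\<close>. Hence \<open>\<alpha>\<close> is a simple root and not a root of the
    cofactor \<open>g\<close>.\<close>
  have "poly (pderiv fc) \<alpha> \<noteq> 0"
  proof
    assume "poly (pderiv fc) \<alpha> = 0"
    then have "ipoly (pderiv f) \<alpha> = 0"
      by (simp add: ipoly_pderiv fc_def)
    then have "pderiv f = 0"
      using irreducible_minimal[OF f \<alpha>'] deg by (simp add: degree_pderiv)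
    then show False
      using deg by (simp add: pderiv_eq_0_iff)
  qed
  then have "poly g \<alpha> \<noteq> 0"
    unfolding g pderiv_mult by (simp add: pderiv_pCons)
  with \<open>poly g \<beta> = 0\<close> have "\<beta> \<noteq> \<alpha>" by auto
  \<comment> \<open>This is a^(d-1) f(X/a). The top coefficient is set apart because the truncated
    exponent \<open>d - 1 - i\<close> would yield \<open>a\<close> instead of 1 at
    \<open>i = d\<close>.\<close>
  define F where "F = (\<Sum>i\<le>d. monom (if i = d then 1 else a ^ (d - 1 - i) * coeff f i) i)"
  have cF: "coeff F i = (if i = d then 1 else if i < d then a ^ (d - 1 - i) * coeff f i else 0)" for i
    by (auto simp: F_def coeff_sum)
  have dF: "degree F = d"
    by (rule antisym[OF degree_le le_degree]) (auto simp: cF)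
  have F: "ipoly F (of_int a * x) = of_int a ^ (d - 1) * ipoly f x" for x :: "'b::comm_ring_1"
  proof -
    have "ipoly F (of_int a * x) = (\<Sum>i\<le>d. of_int (coeff F i) * (of_int a * x) ^ i)"
      by (simp add: ipoly_altdef dF)
    also have "\<dots> = (\<Sum>i\<le>d. of_int a ^ (d - 1) * (of_int (coeff f i) * x ^ i))"
    proof (rule sum.cong[OF refl])
      fix i assume "i \<in> {..d}"
      then consider "i = d" | "i < d" by fastforce
      then show "of_int (coeff F i) * (of_int a * x) ^ i = of_int a ^ (d - 1) * (of_int (coeff f i) * x ^ i)"
      proof cases
        case 1
        have "of_int a ^ d = of_int a ^ (d - 1) * (of_int a :: 'b)"
          using deg by (simp add: d_def flip: power_Suc2)
        then show ?thesis
          using 1 by (simp add: cF power_mult_distrib a_def d_def mult_ac)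
      next
        case 2
        then have "of_int a ^ (d - 1) = of_int a ^ (d - 1 - i) * (of_int a ^ i :: 'b)"
          by (simp flip: power_add)
        then show ?thesis
          using 2 by (simp add: cF power_mult_distrib mult_ac)
      qed
    qed
    also have "\<dots> = of_int a ^ (d - 1) * ipoly f x"
      by (simp add: ipoly_altdef d_def sum_distrib_left)
    finally show ?thesis .
  qed
  interpret monic_min_poly F "of_int a * \<alpha>"
  proof
    show "lead_coeff F = 1" by (simp add: dF cF)
    show "ipoly F (of_int a * \<alpha>) = 0" using F[of \<alpha>] \<alpha>' by simp
  next
    fix h assume h: "ipoly h (of_int a * \<alpha>) = 0" "degree h < degree F"
    have "ipoly (pcompose h [:0, a:]) \<alpha> = 0"
      using h(1) by (simp add: ipoly_pcompose mult.commute)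
    moreover have "degree (pcompose h [:0, a:]) < degree f"
      using h(2) a dF by (simp add: degree_pcompose d_def)
    ultimately have "pcompose h [:0, a:] = 0"
      by (rule irreducible_minimal[OF f \<alpha>'])
    then show "h = 0"
      using a by (simp add: pcompose_eq_0_iff)
  qed
  have "ipoly F (of_int a * \<beta>) = 0"
    using F[of \<beta>] \<beta> by simp
  moreover have "of_int a * \<beta> \<noteq> of_int a * \<alpha>"
    using a \<open>\<beta> \<noteq> \<alpha>\<close> by simp
  ultimately obtain m where m: "m > 0" "\<forall>x. \<not> m dvd poly F x"
    using ex_modulus_without_root by blast
  \<comment> \<open>A root \<open>x\<close> of \<open>f\<close> modulo \<open>m\<close> would make
    \<open>a * x\<close> a root of \<open>F\<close>.\<close>
  have "\<not> m dvd poly f x" for x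
  proof
    assume "m dvd poly f x"
    moreover have "poly F (a * x) = a ^ (d - 1) * poly f x"
      using F[of x] by (simp add: ipoly_int)
    ultimately show False
      using m(2) by (metis dvd_mult)
  qed
  with m(1) show ?thesis by blast
qed

section \<open>Finiteness of the solutions\<close>

theorem corollary1p2:
  fixes r :: nat
    and Q :: "nat \<Rightarrow> int poly"
    and l :: "nat \<Rightarrow> nat"
    and A :: "nat \<Rightarrow> int"
    and f :: "int poly"
  assumes "r \<ge> 1"
    and "\<And>i. i \<in> {1..r} \<Longrightarrow> Q i \<noteq> 0"
    and "\<And>i. i \<in> {1..r} \<Longrightarrow> order 0 (Q i) = l i"
    and "\<And>i. i \<in> {1..r} \<Longrightarrow> l i > 0"
    and "\<And>i. i \<in> {1..r} \<Longrightarrow> A i > 0"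
    and "irreducible f"
    and "degree f > (\<Sum>i=1..r. l i)"
  shows "finite {(n, x). n \<in> {1..r} \<rightarrow>\<^sub>E (UNIV :: nat set) \<and>
           (\<Prod>i=1..r. poly (Q i) (A i ^ n i * fact (n i))) = poly f (x :: int)}"
proof -
  define lhs where "lhs = (\<lambda>n. \<Prod>i=1..r. poly (Q i) (A i ^ n i * fact (n i)))"
  \<comment> \<open>As \<open>l 1\<close> is positive, the degree of \<open>f\<close> exceeds
    1.\<close>
  have "l 1 \<le> (\<Sum>i=1..r. l i)"
    using assms(1) by (intro member_le_sum) auto
  with assms(4)[of 1] assms(1,7) have deg: "degree f \<ge> 2"
    by simp
  obtain m where m: "m > 0" "\<forall>x. \<not> m dvd poly f x"
    using irreducible_ex_modulus_without_root[OF assms(6) deg] by blast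
  have small: "n i < nat m" if i: "i \<in> {1..r}" and eq: "lhs n = poly f x" for n i x
  proof (rule ccontr)
    assume "\<not> n i < nat m"
    then have "nat m dvd fact (n i)"
      using m(1) by (intro dvd_fact) auto
    then have "int (nat m) dvd int (fact (n i))"
      by (simp only: int_dvd_int_iff)
    then have "m dvd A i ^ n i * fact (n i)"
      using m(1) by simp
    then have "[A i ^ n i * fact (n i) = 0] (mod m)"
      by (simp add: cong_0_iff)
    then have "[poly (Q i) (A i ^ n i * fact (n i)) = poly (Q i) 0] (mod m)"
      by (rule poly_cong_int)
    moreover have "poly (Q i) 0 = 0"
      using assms(2-4)[OF i] order_root[of "Q i" 0] by simp
    ultimately have "m dvd poly (Q i) (A i ^ n i * fact (n i))"
      by (simp add: cong_0_iff)
    also have "\<dots> dvd lhs n"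
      unfolding lhs_def using i by (intro dvd_prodI) auto
    finally show False
      using m(2) eq by simp
  qed
  \<comment> \<open>Only finitely many tuples remain, and for each of them \<open>x\<close> is a
    root of a nonzero polynomial.\<close>
  have "{(n, x). n \<in> {1..r} \<rightarrow>\<^sub>E (UNIV :: nat set) \<and> lhs n = poly f x}
      \<subseteq> (SIGMA n:{1..r} \<rightarrow>\<^sub>E {..<nat m}. {x. poly (f - [:lhs n:]) x = 0})"
  proof
    fix u assume "u \<in> {(n, x). n \<in> {1..r} \<rightarrow>\<^sub>E (UNIV :: nat set) \<and> lhs n = poly f x}"
    then obtain n x where u: "u = (n, x)" "n \<in> {1..r} \<rightarrow>\<^sub>E UNIV" "lhs n = poly f x"
      by blast
    then have "n \<in> {1..r} \<rightarrow>\<^sub>E {..<nat m}"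
      using small unfolding PiE_iff by blast
    with u show "u \<in> (SIGMA n:{1..r} \<rightarrow>\<^sub>E {..<nat m}. {x. poly (f - [:lhs n:]) x = 0})"
      by simp
  qed
  moreover have "finite (SIGMA n:{1..r} \<rightarrow>\<^sub>E {..<nat m}. {x. poly (f - [:lhs n:]) x = 0})"
  proof (intro finite_SigmaI finite_PiE poly_roots_finite)
    fix n
    show "f - [:lhs n:] \<noteq> 0"
    proof
      assume "f - [:lhs n:] = 0"
      then have "f = [:lhs n:]" by simp
      then have "degree f = 0" by (metis degree_pCons_0)
      with deg show False by simp
    qed
  qed auto
  ultimately show ?thesis
    unfolding lhs_def by (rule finite_subset)
qed

end
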